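(* Let $\mathcal B_0$ be an admissible initial Bänsch marked mesh. For every finite or infinite Bänsch refinement history from $\mathcal B_0$ generated by selection strategies, there exists a resolution $\rho\in\Sigma_{\mathrm B}$, depending on the history but fixed throughout it, such that, at every complete-batch boundary, the Bänsch execution and the AMP execution from $\mathcal T_0^\rho$ using the same marking sets have the same active tetrahedra, the same face marks, and corresponding states. Every bisection performed up to that boundary uses the same geometric edge in both executions.
   Context: **Notation.** Tetrahedra are closed and nondegenerate in $\mathbb R^3$; $[\cdot]$ is the convex hull; $\mathcal E,\mathcal V,\mathcal F$ denote edges, vertices, triangular faces; $\operatorname{mid}$ is the midpoint. A tetrahedral mesh of a polyhedral domain $\Omega$ is a finite collection of tetrahedra with pairwise disjoint interiors and union $\overline\Omega$; it is conforming if two distinct elements intersect in the empty set, a common vertex, edge or face. A hanging vertex of an element $K$ of the current mesh is a vertex $z$ of the current mesh with $z\in\partial K\setminus\mathcal V(K)$. **BÄNSCH SIDE.** *Face marking.* A Bänsch face marking assigns to each triangular face $F$ (as a geometric object, independently of the side) an edge $\mu_F\in\mathcal E(F)$. The set of global refinement edges of $K$ is $\mathcal G(K)=\{e\in\mathcal E(K):\mu_F=e\text{ for both faces }F\subset K\text{ containing }e\}$. The marking is admissible if $\mathcal G(K)\neq\varnothing$ for every $K$ (then $\#\mathcal G(K)\in\{1,2\}$). Given a selected $[a,b]\in\mathcal G(K)$ with remaining vertices $c,d$, put $\mu_a=\mu_{[a,c,d]}$, $\mu_b=\mu_{[b,c,d]}$. $K$ is red if $(\mu_a,\mu_b)\in\{([a,c],[b,d]),([a,d],[b,c])\}$,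 black if $(\mu_a,\mu_b)\in\{([a,c],[b,c]),([a,d],[b,d])\}$, otherwise unnamed (exactly one, or both, of $\mu_a,\mu_b$ equal $[c,d]$). *Bisection.* Each tetrahedron carries a state $\varepsilon_K\in\{0,1\}$. Bisecting $K$ along a selected $[a,b]\in\mathcal G(K)$, with $z=\operatorname{mid}([a,b])$, gives $K_a=[a,z,c,d]$, $K_b=[b,z,c,d]$ with: (R1) an inherited face (a face of $K$) keeps its mark; (R2) a cut face is marked by its edge opposite $z$; (R3) if $\varepsilon_K=0$, $\mu_{[z,c,d]}=[c,d]$; if $\varepsilon_K=1$ (then $K$ is black with $(\mu_a,\mu_b)=([a,w],[b,w])$ for a unique $w\in\{c,d\}$), $\mu_{[z,c,d]}=[z,w]$; (R4) $\varepsilon_{K_i}=1$ iff $K_i$ and $K$ are both black ($i\in\{a,b\}$). Every child has a unique global refinement edge, so only unbisected initial tetrahedra can have two. *Initial mesh.* An admissible initial Bänsch marked mesh $\mathcal B_0$ is a finite conforming tetrahedral mesh with an admissible face marking and $\varepsilon_K=0$ for all $K$. *Selection and refinement.* A selection strategy assigns, at the first bisection of an initial tetrahedron $K$ with $\#\mathcal G(K)=2$, one edge of $\mathcal G(K)$, possibly depending on the whole preceding batch history (all choices in a batch use the history at the start of the batch). All other tetrahedra are bisected along the unique element of $\mathcal G(K)$. A refinement call on a conforming Bänsch marked mesh $\mathcal B$ with marking set $\mathcal M\subseteq\mathcal B$: set $\mathcal S=\mathcal M$; while $\mathcal S\neq\varnothing$, simultaneously bisect all elements of $\mathcal S$ (one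 batch) and let $\mathcal S$ be the set of elements of the new current mesh having a hanging vertex. A Bänsch refinement history is a finite or infinite sequence of batches produced by successive such calls with marking sets and selection strategies (an infinite history may consist of finitely many completed calls followed by a call whose loop does not stop). Complete-batch boundaries are the times at which no batch is partially executed. **AMP SIDE.** *Marked tetrahedron.* A tetrahedron $K$ with a refinement edge $e(K)$, a marked edge $\mu_F\in\mathcal E(F)$ for every face $F$, and a Boolean flag, such that the two faces containing $e(K)$ have mark $e(K)$; the flag may be set only if the four marks are coplanar. The other two faces are the nonrefinement faces. Types: $P$ if all face marks are coplanar ($P_u$ flag unset, $P_f$ flag set); $A$ if the marks of both nonrefinement faces meet $e(K)$ but the four marks are not coplanar; $O$ if neither of these marks meets $e(K)$; $M$ if exactly one does. *Bisection.* For $K=[v_0,v_1,v_2,v_3]$ with $e(K)=[v_0,v_1]$, $m=\operatorname{mid}([v_0,v_1])$, the children are $[v_0,m,v_2,v_3]$, $[m,v_1,v_2,v_3]$: an inherited face keeps its mark, which is the child's refinement edge; a cut face is marked by its edge opposite $m$; the new face $[m,v_2,v_3]$ is marked by $[v_2,v_3]$, except if $K$ has type $P_f$, when it is marked by $[m,w]$, $w\in\{v_2,v_3\}$ being the common old endpoint of the two child refinement edges; the child flags are set iff $K$ has type $P_u$. *Execution.* An AMP call with marking set $\mathcal M$ bisects all elements of $\mathcal M$ (first batch) and then, as long as some elements of the current mesh have hanging vertices, simultaneously bisects all of them (one batch each time), always along $e(K)$. **RESOLUTIONS.** $\mathfrak D_0=\{K\in\mathcal B_0:\#\mathcal G(K)=2\}$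 and $\Sigma_{\mathrm B}=\prod_{K\in\mathfrak D_0}\mathcal G(K)$; its elements $\rho$ (choices $\rho(K)\in\mathcal G(K)$, $K\in\mathfrak D_0$) are resolutions. $\mathcal T_0^\rho$ is the AMP marked mesh with the same tetrahedra and face marks as $\mathcal B_0$, refinement edge $\rho(K)$ for $K\in\mathfrak D_0$ and the unique element of $\mathcal G(K)$ for the other $K\in\mathcal B_0$, and all flags unset. **Corresponding states.** With the selected global edge as AMP refinement edge, the Bänsch configurations red, black with $\varepsilon_K=0$, black with $\varepsilon_K=1$, unnamed with exactly one of $\mu_a,\mu_b$ equal to $[c,d]$, unnamed with both equal to $[c,d]$ correspond respectively to the AMP types $A,P_u,P_f,M,O$. *)

theory Defs
  imports "HOL-Analysis.Analysis" "HOL-Library.Extended_Nat"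
begin

section \<open>Tetrahedra and meshes\<close>

text \<open>
  A simplex (tetrahedron, triangular face, edge) is represented by its set of vertices; the closed
  point set is the \<open>convex hull\<close> of that set. Vertices of a nondegenerate simplex are the extreme
  points of its hull, so equality of vertex sets is equality of geometric objects, and two edges of a
  tetrahedron meet iff they share an endpoint.
\<close>

type_synonym pt = "real ^ 3"
type_synonym edge = "pt set"
type_synonym face = "pt set"
type_synonym tet = "pt set"

definition tetrahedron :: "tet \<Rightarrow> bool" where
  "tetrahedron K \<longleftrightarrow> card K = 4 \<and> \<not> affine_dependent K"

definition edges :: "pt set \<Rightarrow> edge set" where
  "edges K = {e. e \<subseteq> K \<and> card e = 2}"

definition faces :: "tet \<Rightarrow> face set" where
  "faces K = {F. F \<subseteq> K \<and> card F = 3}"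

definition mid :: "edge \<Rightarrow> pt" where
  "mid e = (THE z. \<exists>a b. e = {a, b} \<and> z = midpoint a b)"

definition polyhedral_domain :: "pt set \<Rightarrow> bool" where
  "polyhedral_domain \<Omega> \<longleftrightarrow> open \<Omega> \<and> connected \<Omega> \<and> \<Omega> \<noteq> {} \<and>
     (\<exists>P. finite P \<and> (\<forall>p\<in>P. polytope p) \<and> closure \<Omega> = \<Union>P)"

definition tetrahedral_mesh :: "pt set \<Rightarrow> tet set \<Rightarrow> bool" where
  "tetrahedral_mesh \<Omega> \<T> \<longleftrightarrow> finite \<T> \<and> (\<forall>K\<in>\<T>. tetrahedron K) \<and>
     (\<forall>K\<in>\<T>. \<forall>L\<in>\<T>. K \<noteq> L \<longrightarrow> interior (convex hull K) \<inter> interior (convex hull L) = {}) \<and>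
     (\<Union>K\<in>\<T>. convex hull K) = closure \<Omega>"

definition conforming :: "tet set \<Rightarrow> bool" where
  "conforming \<T> \<longleftrightarrow> (\<forall>K\<in>\<T>. \<forall>L\<in>\<T>. K \<noteq> L \<longrightarrow>
     (let I = convex hull K \<inter> convex hull L in
        I = {} \<or> (\<exists>v\<in>K \<inter> L. I = {v}) \<or> (\<exists>e\<in>edges K \<inter> edges L. I = convex hull e) \<or>
        (\<exists>F\<in>faces K \<inter> faces L. I = convex hull F)))"

definition hanging_elements :: "tet set \<Rightarrow> tet set" where
  "hanging_elements \<T> = {K \<in> \<T>. \<exists>z\<in>\<Union>\<T>. z \<in> frontier (convex hull K) \<and> z \<notin> K}"

text \<open>The child of \<open>K\<close>, bisected along \<open>e\<close>, that retains the endpoint \<open>x \<in> e\<close>.\<close>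

definition child :: "tet \<Rightarrow> edge \<Rightarrow> pt \<Rightarrow> tet" where
  "child K e x = insert (mid e) (K - (e - {x}))"

text \<open>The elements bisected in batch \<open>j\<close> (counted from 0) of a call with marking set \<open>M\<close>, if the
  mesh before that batch is \<open>\<T>\<close>. This is common to both algorithms.\<close>

definition batch_set :: "tet set \<Rightarrow> tet set \<Rightarrow> nat \<Rightarrow> tet set" where
  "batch_set M \<T> j = (if j = 0 then M else hanging_elements \<T>)"


section \<open>Baensch refinement\<close>

text \<open>Face marks depend on the geometric face only, not on an adjacent element. The values of
  \<open>fmark\<close> and \<open>eps\<close> off the current mesh are irrelevant; \<open>eps\<close> is true for state 1.\<close>

record bmesh =
  tets :: "tet set"
  fmark :: "face \<Rightarrow> edge"
  eps :: "tet \<Rightarrow> bool"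

definition face_marking :: "tet set \<Rightarrow> (face \<Rightarrow> edge) \<Rightarrow> bool" where
  "face_marking \<T> \<mu> \<longleftrightarrow> (\<forall>K\<in>\<T>. \<forall>F\<in>faces K. \<mu> F \<in> edges F)"

definition gedges :: "(face \<Rightarrow> edge) \<Rightarrow> tet \<Rightarrow> edge set" where
  "gedges \<mu> K = {e \<in> edges K. \<forall>F\<in>faces K. e \<subseteq> F \<longrightarrow> \<mu> F = e}"

definition admissible :: "tet set \<Rightarrow> (face \<Rightarrow> edge) \<Rightarrow> bool" where
  "admissible \<T> \<mu> \<longleftrightarrow> (\<forall>K\<in>\<T>. gedges \<mu> K \<noteq> {})"

definition labels :: "tet \<Rightarrow> edge \<Rightarrow> pt \<Rightarrow> pt \<Rightarrow> pt \<Rightarrow> pt \<Rightarrow> bool" where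
  "labels K e a b c d \<longleftrightarrow> distinct [a, b, c, d] \<and> K = {a, b, c, d} \<and> e = {a, b}"

text \<open>The configurations below are invariant under the relabellings left open by \<open>labels\<close>.\<close>

definition red :: "(face \<Rightarrow> edge) \<Rightarrow> tet \<Rightarrow> edge \<Rightarrow> bool" where
  "red \<mu> K e \<longleftrightarrow> (\<exists>a b c d. labels K e a b c d \<and>
     (\<mu> {a, c, d}, \<mu> {b, c, d}) \<in> {({a, c}, {b, d}), ({a, d}, {b, c})})"

definition black :: "(face \<Rightarrow> edge) \<Rightarrow> tet \<Rightarrow> edge \<Rightarrow> bool" where
  "black \<mu> K e \<longleftrightarrow> (\<exists>a b c d. labels K e a b c d \<and>
     (\<mu> {a, c, d}, \<mu> {b, c, d}) \<in> {({a, c}, {b, c}), ({a, d}, {b, d})})"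

definition unnamed_one :: "(face \<Rightarrow> edge) \<Rightarrow> tet \<Rightarrow> edge \<Rightarrow> bool" where
  "unnamed_one \<mu> K e \<longleftrightarrow> \<not> red \<mu> K e \<and> \<not> black \<mu> K e \<and>
     (\<exists>a b c d. labels K e a b c d \<and> (\<mu> {a, c, d} = {c, d}) \<noteq> (\<mu> {b, c, d} = {c, d}))"

definition unnamed_both :: "(face \<Rightarrow> edge) \<Rightarrow> tet \<Rightarrow> edge \<Rightarrow> bool" where
  "unnamed_both \<mu> K e \<longleftrightarrow> \<not> red \<mu> K e \<and> \<not> black \<mu> K e \<and>
     (\<exists>a b c d. labels K e a b c d \<and> \<mu> {a, c, d} = {c, d} \<and> \<mu> {b, c, d} = {c, d})"

definition admissible_initial :: "bmesh \<Rightarrow> bool" where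
  "admissible_initial B \<longleftrightarrow>
     (\<exists>\<Omega>. polyhedral_domain \<Omega> \<and> tetrahedral_mesh \<Omega> (tets B)) \<and> conforming (tets B) \<and>
     face_marking (tets B) (fmark B) \<and> admissible (tets B) (fmark B) \<and>
     (\<forall>K\<in>tets B. \<not> eps B K)"

text \<open>
  \<open>bansch_batch B S E B'\<close>: the marked mesh \<open>B'\<close> results from \<open>B\<close> by bisecting simultaneously every
  \<open>K \<in> S\<close> along \<open>E K\<close>. All admissible labellings of \<open>K\<close> are quantified, so the rules as written
  for one labelling cover both inherited and all four cut faces.
\<close>

definition bansch_batch :: "bmesh \<Rightarrow> tet set \<Rightarrow> (tet \<Rightarrow> edge) \<Rightarrow> bmesh \<Rightarrow> bool" where
  "bansch_batch B S E B' \<longleftrightarrow>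
     (let \<mu> = fmark B; \<mu>' = fmark B' in
       tets B' = (tets B - S) \<union> (\<Union>K\<in>S. child K (E K) ` E K) \<and>
       (\<forall>K\<in>tets B - S. (\<forall>F\<in>faces K. \<mu>' F = \<mu> F) \<and> eps B' K = eps B K) \<and>
       (\<forall>K\<in>S. \<forall>a b c d. labels K (E K) a b c d \<longrightarrow>
         (let z = mid {a, b} in
           \<comment> \<open>inherited faces\<close>
           \<mu>' {a, c, d} = \<mu> {a, c, d} \<and>
           \<comment> \<open>cut faces: the edge opposite \<open>z\<close>\<close>
           \<mu>' {a, z, c} = {a, c} \<and>
           \<comment> \<open>the new face\<close>
           \<mu>' {z, c, d} =
             (if eps B K
              then {z, THE w. w \<in> {c, d} \<and> \<mu> {a, c, d} = {a, w} \<and> \<mu> {b, c, d} = {b, w}}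
              else {c, d}))) \<and>
       \<comment> \<open>the states of the children\<close>
       (\<forall>K\<in>S. \<forall>C\<in>child K (E K) ` E K.
          eps B' C \<longleftrightarrow> black \<mu> K (E K) \<and> (\<exists>e\<in>gedges \<mu>' C. black \<mu>' C e)))"

text \<open>The initial tetrahedra with two global refinement edges, and the resolutions.\<close>

definition D0 :: "bmesh \<Rightarrow> tet set" where
  "D0 B = {K \<in> tets B. card (gedges (fmark B) K) = 2}"

definition resolutions :: "bmesh \<Rightarrow> (tet \<Rightarrow> edge) set" where
  "resolutions B = (\<Pi>\<^sub>E K\<in>D0 B. gedges (fmark B) K)"

text \<open>A batch is recorded as the set of pairs of a bisected tetrahedron and its bisection edge.\<close>

type_synonym batch = "(tet \<times> edge) set"
type_synonym strategy = "batch list \<Rightarrow> tet \<Rightarrow> edge"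

definition selection_strategy :: "bmesh \<Rightarrow> strategy \<Rightarrow> bool" where
  "selection_strategy B0 \<sigma> \<longleftrightarrow> (\<forall>h. \<forall>K\<in>D0 B0. \<sigma> h K \<in> gedges (fmark B0) K)"

text \<open>
  A history consists of \<open>ncalls\<close> calls, call \<open>i\<close> having marking set \<open>marking i\<close> and performing
  \<open>nbatches i\<close> batches (both numbers possibly infinite). \<open>bstate i j\<close> is the marked mesh after
  \<open>j\<close> batches of call \<open>i\<close>, and \<open>bedge i j K\<close> the edge along which \<open>K\<close> is bisected in batch \<open>j\<close>
  (counted from 0) of call \<open>i\<close>.
\<close>

record history =
  ncalls :: enat
  marking :: "nat \<Rightarrow> tet set"
  nbatches :: "nat \<Rightarrow> enat"
  bstate :: "nat \<Rightarrow> nat \<Rightarrow> bmesh"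
  bedge :: "nat \<Rightarrow> nat \<Rightarrow> tet \<Rightarrow> edge"

definition hset :: "history \<Rightarrow> nat \<Rightarrow> nat \<Rightarrow> tet set" where
  "hset H i j = batch_set (marking H i) (tets (bstate H i j)) j"

definition hbatch :: "history \<Rightarrow> nat \<Rightarrow> nat \<Rightarrow> batch" where
  "hbatch H i j = {(K, bedge H i j K) | K. K \<in> hset H i j}"

text \<open>All batches performed before batch \<open>j\<close> of call \<open>i\<close>.\<close>

definition past :: "history \<Rightarrow> nat \<Rightarrow> nat \<Rightarrow> batch list" where
  "past H i j =
     concat (map (\<lambda>k. map (hbatch H k) [0..<the_enat (nbatches H k)]) [0..<i]) @
     map (hbatch H i) [0..<j]"

text \<open>
  Every call but the last one runs to completion; the last one, if any, may be completed,
  interrupted after a complete batch, or run forever. The strategy may change from call to call.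
  An initial tetrahedron is never active again once it is bisected, so \<open>K \<in> D0 B0\<close> below
  singles out the first bisection of an initial tetrahedron with two global refinement edges.
\<close>

definition bansch_history :: "bmesh \<Rightarrow> (nat \<Rightarrow> strategy) \<Rightarrow> history \<Rightarrow> bool" where
  "bansch_history B0 \<sigma> H \<longleftrightarrow>
     bstate H 0 0 = B0 \<and>
     (\<forall>i. enat i < ncalls H \<longrightarrow>
        conforming (tets (bstate H i 0)) \<and> marking H i \<subseteq> tets (bstate H i 0) \<and>
        (\<forall>j. enat j < nbatches H i \<longrightarrow>
           hset H i j \<noteq> {} \<and>
           (\<forall>K\<in>hset H i j.
              if K \<in> D0 B0 then bedge H i j K = \<sigma> i (past H i j) K
              else gedges (fmark (bstate H i j)) K = {bedge H i j K}) \<and>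
           bansch_batch (bstate H i j) (hset H i j) (bedge H i j) (bstate H i (Suc j)))) \<and>
     (\<forall>i. enat (Suc i) < ncalls H \<longrightarrow>
        (\<exists>l. nbatches H i = enat l \<and> hset H i l = {} \<and> bstate H (Suc i) 0 = bstate H i l))"

text \<open>The complete-batch boundaries, including the initial time (the only one if there is no
  call).\<close>

definition boundary :: "history \<Rightarrow> nat \<Rightarrow> nat \<Rightarrow> bool" where
  "boundary H i j \<longleftrightarrow> i = 0 \<and> j = 0 \<or> enat i < ncalls H \<and> enat j \<le> nbatches H i"


section \<open>AMP refinement\<close>

record mtet =
  verts :: tet
  refedge :: edge
  mark :: "face \<Rightarrow> edge"
  flag :: bool

definition coplanar_marks :: "mtet \<Rightarrow> bool" where
  "coplanar_marks t \<longleftrightarrow> coplanar (\<Union>F\<in>faces (verts t). mark t F)"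

definition marked_tetrahedron :: "mtet \<Rightarrow> bool" where
  "marked_tetrahedron t \<longleftrightarrow> tetrahedron (verts t) \<and> refedge t \<in> edges (verts t) \<and>
     (\<forall>F\<in>faces (verts t). mark t F \<in> edges F \<and> (refedge t \<subseteq> F \<longrightarrow> mark t F = refedge t)) \<and>
     (flag t \<longrightarrow> coplanar_marks t)"

definition nonref_faces :: "mtet \<Rightarrow> face set" where
  "nonref_faces t = {F \<in> faces (verts t). \<not> refedge t \<subseteq> F}"

definition type_Pu :: "mtet \<Rightarrow> bool" where
  "type_Pu t \<longleftrightarrow> coplanar_marks t \<and> \<not> flag t"

definition type_Pf :: "mtet \<Rightarrow> bool" where
  "type_Pf t \<longleftrightarrow> coplanar_marks t \<and> flag t"

definition type_A :: "mtet \<Rightarrow> bool" where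
  "type_A t \<longleftrightarrow> (\<forall>F\<in>nonref_faces t. mark t F \<inter> refedge t \<noteq> {}) \<and> \<not> coplanar_marks t"

definition type_O :: "mtet \<Rightarrow> bool" where
  "type_O t \<longleftrightarrow> (\<forall>F\<in>nonref_faces t. mark t F \<inter> refedge t = {})"

definition type_M :: "mtet \<Rightarrow> bool" where
  "type_M t \<longleftrightarrow> (\<exists>!F. F \<in> nonref_faces t \<and> mark t F \<inter> refedge t \<noteq> {})"

text \<open>For \<open>x \<in> refedge t\<close>, the face \<open>K - (e - {x})\<close> is the inherited face of the child retaining
  \<open>x\<close>, and its remaining faces are the new face \<open>insert m (K - e)\<close> and two cut faces, which contain
  both \<open>x\<close> and \<open>m\<close>.\<close>

definition amp_child :: "mtet \<Rightarrow> pt \<Rightarrow> mtet" where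
  "amp_child t x =
     (let K = verts t; e = refedge t; m = mid e; inh = (\<lambda>y. K - (e - {y})) in
      \<lparr> verts = child K e x,
        refedge = mark t (inh x),
        mark = (\<lambda>F. if F = inh x then mark t F
                    else if F = insert m (K - e) then
                      (if type_Pf t
                       then {m, THE w. w \<in> K - e \<and> (\<forall>y\<in>e. w \<in> mark t (inh y))}
                       else K - e)
                    else F - {m}),
        flag = type_Pu t \<rparr>)"

definition amp_batch :: "mtet set \<Rightarrow> tet set \<Rightarrow> mtet set" where
  "amp_batch T S = {t \<in> T. verts t \<notin> S} \<union> (\<Union>t\<in>{t \<in> T. verts t \<in> S}. amp_child t ` refedge t)"

text \<open>
  \<open>amp_reach T0 M i j T\<close>: the AMP execution from \<open>T0\<close> with marking sets \<open>M 0, M 1, \<dots>\<close> reaches the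
  boundary after \<open>j\<close> batches of call \<open>i\<close>, and its marked mesh is then \<open>T\<close>. The first batch of a call
  is always performed, even if it is empty.
\<close>

inductive amp_reach :: "mtet set \<Rightarrow> (nat \<Rightarrow> tet set) \<Rightarrow> nat \<Rightarrow> nat \<Rightarrow> mtet set \<Rightarrow> bool"
  for T0 M where
  start: "amp_reach T0 M 0 0 T0"
| first: "amp_reach T0 M i 0 T \<Longrightarrow> M i \<subseteq> verts ` T \<Longrightarrow>
    amp_reach T0 M i (Suc 0) (amp_batch T (batch_set (M i) (verts ` T) 0))"
| loop: "amp_reach T0 M i (Suc j) T \<Longrightarrow> hanging_elements (verts ` T) \<noteq> {} \<Longrightarrow>
    amp_reach T0 M i (Suc (Suc j)) (amp_batch T (batch_set (M i) (verts ` T) (Suc j)))"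
| return: "amp_reach T0 M i (Suc j) T \<Longrightarrow> hanging_elements (verts ` T) = {} \<Longrightarrow>
    amp_reach T0 M (Suc i) 0 T"

text \<open>The execution is deterministic.\<close>

lemma amp_reach_prefix:
  assumes "amp_reach T0 M i (Suc k) T" "m < k"
  shows "\<exists>S. amp_reach T0 M i (Suc m) S \<and> hanging_elements (verts ` S) \<noteq> {}"
  using assms
proof (induction k arbitrary: T)
  case (Suc k)
  from Suc.prems(1) obtain S where S: "amp_reach T0 M i (Suc k) S"
      "hanging_elements (verts ` S) \<noteq> {}"
    by (cases rule: amp_reach.cases) auto
  show ?case using Suc.IH[OF S(1)] S Suc.prems(2) by (cases "m = k") auto
qed simp

lemma amp_reach_unique:
  assumes "amp_reach T0 M i j T" "amp_reach T0 M i j T'"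
  shows "T = T'"
  using assms
proof (induction i arbitrary: j T T')
  case 0
  then show ?case
  proof (induction j arbitrary: T T')
    case 0
    then show ?case by (auto elim: amp_reach.cases)
  next
    case (Suc j)
    from Suc.prems(1) obtain S where S: "amp_reach T0 M 0 j S"
        "T = amp_batch S (batch_set (M 0) (verts ` S) j)"
      by (cases rule: amp_reach.cases) auto
    from Suc.prems(2) obtain S' where S': "amp_reach T0 M 0 j S'"
        "T' = amp_batch S' (batch_set (M 0) (verts ` S') j)"
      by (cases rule: amp_reach.cases) auto
    show ?case using Suc.IH[OF S(1) S'(1)] S(2) S'(2) by simp
  qed
next
  case (Suc i)
  note IH = Suc.IH
  from Suc.prems show ?case
  proof (induction j arbitrary: T T')
    case 0
    from 0(1) obtain k where k: "amp_reach T0 M i (Suc k) T" "hanging_elements (verts ` T) = {}"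
      by (cases rule: amp_reach.cases) auto
    from 0(2) obtain l where l: "amp_reach T0 M i (Suc l) T'" "hanging_elements (verts ` T') = {}"
      by (cases rule: amp_reach.cases) auto
    have "\<not> k < l" using amp_reach_prefix[OF l(1)] IH[OF k(1)] k(2) by metis
    moreover have "\<not> l < k" using amp_reach_prefix[OF k(1)] IH[OF l(1)] l(2) by metis
    ultimately have "k = l" by simp
    then show ?case using IH k(1) l(1) by blast
  next
    case (Suc j)
    from Suc.prems(1) obtain S where S: "amp_reach T0 M (Suc i) j S"
        "T = amp_batch S (batch_set (M (Suc i)) (verts ` S) j)"
      by (cases rule: amp_reach.cases) auto
    from Suc.prems(2) obtain S' where S': "amp_reach T0 M (Suc i) j S'"
        "T' = amp_batch S' (batch_set (M (Suc i)) (verts ` S') j)"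
      by (cases rule: amp_reach.cases) auto
    show ?case using Suc.IH[OF S(1) S'(1)] S(2) S'(2) by simp
  qed
qed

text \<open>The marked mesh determined by a resolution.\<close>

definition amp_init :: "bmesh \<Rightarrow> (tet \<Rightarrow> edge) \<Rightarrow> mtet set" where
  "amp_init B \<rho> =
     (\<lambda>K. \<lparr> verts = K,
            refedge = (if K \<in> D0 B then \<rho> K else (THE e. e \<in> gedges (fmark B) K)),
            mark = fmark B, flag = False \<rparr>) ` tets B"


section \<open>Comparison\<close>

definition corresponding :: "bmesh \<Rightarrow> mtet \<Rightarrow> bool" where
  "corresponding B t \<longleftrightarrow>
     (let \<mu> = fmark B; K = verts t; e = refedge t in
       e \<in> gedges \<mu> K \<and>
       (red \<mu> K e \<and> type_A t \<or>
        black \<mu> K e \<and> \<not> eps B K \<and> type_Pu t \<or>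
        black \<mu> K e \<and> eps B K \<and> type_Pf t \<or>
        unnamed_one \<mu> K e \<and> type_M t \<or>
        unnamed_both \<mu> K e \<and> type_O t))"

text \<open>The first two conjuncts say that the active tetrahedra are the same and that each one
  occurs with a single AMP marking.\<close>

definition matching :: "bmesh \<Rightarrow> mtet set \<Rightarrow> bool" where
  "matching B T \<longleftrightarrow>
     verts ` T = tets B \<and> inj_on verts T \<and>
     (\<forall>t\<in>T. marked_tetrahedron t \<and> (\<forall>F\<in>faces (verts t). mark t F = fmark B F) \<and>
        corresponding B t)"

text \<open>Batch \<open>j\<close> of call \<open>i\<close> bisects the same tetrahedra along the same edges in both executions.\<close>

definition same_bisections :: "history \<Rightarrow> mtet set \<Rightarrow> nat \<Rightarrow> nat \<Rightarrow> bool" where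
  "same_bisections H T0 i j \<longleftrightarrow>
     (\<exists>T. amp_reach T0 (marking H) i j T \<and>
        hbatch H i j =
          {(verts t, refedge t) | t. t \<in> T \<and> verts t \<in> batch_set (marking H i) (verts ` T) j})"

end

theory Submission
  imports Defs
begin

text \<open>
  The proof is a simulation. An AMP tetrahedron represents its Baensch counterpart if both have the
  same face marks and the flag equals the state; this is preserved by a bisection along the same
  edge, since the children of a tetrahedron with state 1 are red and all other children are black.
  An unambiguous global refinement edge must be the AMP refinement edge. An ambiguous one occurs only
  at the first bisection of an initial tetrahedron \<open>K\<close>. Since descendants are nonoverlapping proper
  subsets of their ancestors, \<open>K\<close> never becomes active again, so it is bisected at most once and
  \<open>\<rho>(K)\<close> can be read off from the history. The same geometric facts exclude two active AMP
  tetrahedra with equal vertex sets.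
\<close>

section \<open>Labelled tetrahedra\<close>

text \<open>AMP sets the flags of the children from the parent alone, (R4) sets the states from
  parent and child; that both agree rests on one computation. Consider the child that keeps
  \<open>a\<close>, with \<open>z\<close> the midpoint. Its cut faces are marked
  \<open>{a, c}\<close> and \<open>{a, d}\<close>, and its refinement edge \<open>r\<close> is the
  inherited mark. If \<open>r = {c, d}\<close>, the two nonrefinement marks meet in \<open>a\<close>
  and the child is black. If \<open>r = {a, c}\<close>, they are \<open>{a, d}\<close> and the mark
  of the new face: with \<open>{c, d}\<close> they meet in \<open>d\<close> and the child is black,
  with \<open>{z, c}\<close> they are disjoint and it is red. The last case is that of state 1,
  where the parent is black and \<open>r = {c, d}\<close> cannot occur. Blackness of the child thus
  says that the parent has state 0, and (R4) becomes the rule that reads off \<open>type_Pu\<close>.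
  Marks prescribed from the two sides of a face cannot conflict, since each state of a history
  carries one function \<open>fmark\<close>; tetrahedra can therefore be compared one at a
  time.\<close>

lemma mid_pair [simp]: "mid {a, b} = midpoint a b"
  unfolding mid_def
  by (rule the_equality) (auto simp: doubleton_eq_iff midpoint_sym)

lemma labels_swap_edge: "labels K e a b c d \<Longrightarrow> labels K e b a c d"
  unfolding labels_def by auto

lemma labels_swap_rest: "labels K e a b c d \<Longrightarrow> labels K e a b d c"
  unfolding labels_def by auto

text \<open>The prescribed endpoint \<open>x\<close> takes the first position, so that a statement
  about the child keeping \<open>a\<close> applies to both children.\<close>

lemma labels_exist:
  assumes "card K = 4" "e \<in> edges K" "x \<in> e"
  obtains b c d where "labels K e x b c d"
proof -
  have K: "finite K" using assms(1) card.infinite by force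
  have e: "e \<subseteq> K" "card e = 2" using assms(2) by (auto simp: edges_def)
  obtain b where b: "e = {x, b}" "x \<noteq> b"
    using e(2) assms(3) by (auto simp: card_2_iff)
  have "card (K - e) = 2"
    using K e assms(1) by (simp add: card_Diff_subset finite_subset)
  then obtain c d where "K - e = {c, d}" "c \<noteq> d" by (auto simp: card_2_iff)
  then have "labels K e x b c d"
    unfolding labels_def using b e(1) by auto
  then show thesis by (rule that)
qed

text \<open>Passing to complements of single points turns both the faces of a tetrahedron and the
  edges of a triangle into explicit lists.\<close>

lemma subsets_of_codim_1:
  assumes "finite K"
  shows "{F. F \<subseteq> K \<and> Suc (card F) = card K} = (\<lambda>x. K - {x}) ` K"
proof (intro equalityI subsetI)
  fix F assume "F \<in> {F. F \<subseteq> K \<and> Suc (card F) = card K}"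
  then have F: "F \<subseteq> K" "Suc (card F) = card K" by auto
  then have "card (K - F) = 1"
    using assms by (simp add: card_Diff_subset finite_subset)
  then obtain x where "K - F = {x}" by (auto simp: card_1_singleton_iff)
  then show "F \<in> (\<lambda>x. K - {x}) ` K" using F(1) by blast
next
  fix F assume "F \<in> (\<lambda>x. K - {x}) ` K"
  then show "F \<in> {F. F \<subseteq> K \<and> Suc (card F) = card K}"
    using assms by (auto simp: card_Diff_singleton) (metis Suc_pred card_gt_0_iff empty_iff)
qed

lemma faces_labels:
  assumes "labels K e a b c d"
  shows "faces K = {{a, b, c}, {a, b, d}, {a, c, d}, {b, c, d}}"
proof -
  have K: "K = {a, b, c, d}" "distinct [a, b, c, d]" using assms by (auto simp: labels_def)
  have "faces K = (\<lambda>x. K - {x}) ` K"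
    using subsets_of_codim_1[of K] K by (simp add: faces_def numeral_3_eq_3)
  also have "\<dots> = {{a, b, c}, {a, b, d}, {a, c, d}, {b, c, d}}"
  proof -
    have "K - {a} = {b, c, d}" "K - {b} = {a, c, d}" "K - {c} = {a, b, d}" "K - {d} = {a, b, c}"
      using K by auto
    then show ?thesis unfolding K(1) by auto
  qed
  finally show ?thesis .
qed

lemma edges_triangle:
  assumes "distinct [a, b, c]"
  shows "edges {a, b, c} = {{a, b}, {a, c}, {b, c}}"
proof -
  have "edges {a, b, c} = (\<lambda>x. {a, b, c} - {x}) ` {a, b, c}"
    using subsets_of_codim_1[of "{a, b, c}"] assms by (simp add: edges_def numeral_2_eq_2)
  also have "\<dots> = {{a, b}, {a, c}, {b, c}}"
  proof -
    have "{a, b, c} - {a} = {b, c}" "{a, b, c} - {b} = {a, c}" "{a, b, c} - {c} = {a, b}"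
      using assms by auto
    then show ?thesis by auto
  qed
  finally show ?thesis .
qed

lemma child_labels:
  assumes "labels K e a b c d"
  shows "child K e a = {a, midpoint a b, c, d}"
  using assms unfolding labels_def child_def by auto

lemma gedges_labels:
  assumes "labels K e a b c d"
  shows "e \<in> gedges \<mu> K \<longleftrightarrow> \<mu> {a, b, c} = e \<and> \<mu> {a, b, d} = e"
  using assms unfolding gedges_def edges_def faces_labels[OF assms]
  by (auto simp: labels_def)

text \<open>Any other edge shares exactly one endpoint with \<open>e\<close> and so lies with
  \<open>e\<close> in a common face, whose mark is already \<open>e\<close>. Two global edges are
  therefore always opposite, and there are never three.\<close>

lemma gedges_opposite:
  assumes "labels K e a b c d" "e \<in> gedges \<mu> K" "f \<in> gedges \<mu> K"
  shows "f = e \<or> f = {c, d}"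
proof (rule ccontr)
  assume *: "\<not> ?thesis"
  have f: "f \<subseteq> {a, b, c, d}" "card f = 2" "\<And>F. F \<in> faces K \<Longrightarrow> f \<subseteq> F \<Longrightarrow> \<mu> F = f"
    using assms by (auto simp: gedges_def edges_def labels_def)
  have "f \<subseteq> {a, b, c} \<or> f \<subseteq> {a, b, d}"
    using f(1,2) * assms(1) by (auto simp: card_2_iff)
  then have "\<mu> {a, b, c} = f \<or> \<mu> {a, b, d} = f"
    using f(3) faces_labels[OF assms(1)] by auto
  then show False using assms(2) * gedges_labels[OF assms(1)] by auto
qed

text \<open>Two labellings of the same \<open>K\<close> and \<open>e\<close> differ only by
  exchanging \<open>a\<close> with \<open>b\<close> and \<open>c\<close> with \<open>d\<close>, and
  the condition is symmetric under both. Hence one labelling decides; the same holds for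
  \<open>red_labels\<close>.\<close>

lemma black_labels:
  assumes "labels K e a b c d"
  shows "black \<mu> K e \<longleftrightarrow> (\<exists>w\<in>{c, d}. \<mu> {a, c, d} = {a, w} \<and> \<mu> {b, c, d} = {b, w})"
proof
  assume "black \<mu> K e"
  then obtain a' b' c' d' where l: "labels K e a' b' c' d'"
    and m: "\<exists>w\<in>{c', d'}. \<mu> {a', c', d'} = {a', w} \<and> \<mu> {b', c', d'} = {b', w}"
    unfolding black_def by auto
  have "{a, b} = {a', b'}" "{c, d} = {c', d'}"
    using l assms unfolding labels_def by auto
  then have "(a = a' \<and> b = b' \<or> a = b' \<and> b = a') \<and> {c, d} = {c', d'}"
    by (auto simp: doubleton_eq_iff)
  then show "\<exists>w\<in>{c, d}. \<mu> {a, c, d} = {a, w} \<and> \<mu> {b, c, d} = {b, w}"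
    using m by auto
next
  assume "\<exists>w\<in>{c, d}. \<mu> {a, c, d} = {a, w} \<and> \<mu> {b, c, d} = {b, w}"
  then show "black \<mu> K e" unfolding black_def using assms by blast
qed

lemma red_labels:
  assumes "labels K e a b c d"
  shows "red \<mu> K e \<longleftrightarrow> \<mu> {a, c, d} = {a, c} \<and> \<mu> {b, c, d} = {b, d} \<or>
    \<mu> {a, c, d} = {a, d} \<and> \<mu> {b, c, d} = {b, c}"
proof
  assume "red \<mu> K e"
  then obtain a' b' c' d' where l: "labels K e a' b' c' d'"
    and m: "\<mu> {a', c', d'} = {a', c'} \<and> \<mu> {b', c', d'} = {b', d'} \<or>
       \<mu> {a', c', d'} = {a', d'} \<and> \<mu> {b', c', d'} = {b', c'}"
    unfolding red_def by auto
  have "{a, b} = {a', b'}" "{c, d} = {c', d'}"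
    using l assms unfolding labels_def by auto
  then have "(a = a' \<and> b = b' \<or> a = b' \<and> b = a') \<and> (c = c' \<and> d = d' \<or> c = d' \<and> d = c')"
    by (auto simp: doubleton_eq_iff)
  then show "\<mu> {a, c, d} = {a, c} \<and> \<mu> {b, c, d} = {b, d} \<or>
    \<mu> {a, c, d} = {a, d} \<and> \<mu> {b, c, d} = {b, c}"
    using m by (elim conjE disjE) (simp_all add: insert_commute)
qed (use assms in \<open>auto simp: red_def\<close>)


section \<open>Geometry of bisection\<close>

lemma tetrahedron_iff_aff_dim: "tetrahedron K \<longleftrightarrow> card K = 4 \<and> aff_dim K = 3"
  unfolding tetrahedron_def affine_independent_iff_card
  by (auto intro: card_ge_0_finite)

lemma tetrahedron_interior:
  assumes "tetrahedron K"
  shows "interior (convex hull K) \<noteq> {}"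
  using assms interior_convex_hull_eq_empty[of K] by (simp add: tetrahedron_def)

text \<open>The vertices are recovered as the extreme points of the hull. This turns a difference of
  vertex sets into a proper inclusion of point sets.\<close>

lemma tetrahedron_hull_eq:
  assumes "tetrahedron K" "tetrahedron L" "convex hull K = convex hull L"
  shows "K = L"
proof -
  have "x \<in> M \<longleftrightarrow> x extreme_point_of (convex hull M)" if "tetrahedron M" for x M
    using extreme_point_of_convex_hull_affine_independent[of M x] that
    by (simp add: tetrahedron_def)
  then show ?thesis using assms by (metis set_eqI)
qed

text \<open>The lost vertex \<open>b\<close> is the reflection of \<open>a\<close> in the midpoint,
  so the affine hull of the child contains \<open>K\<close>; at most four points spanning dimension
  3 are affinely independent.\<close>

lemma child_tetrahedron:
  assumes "tetrahedron K" "labels K e a b c d"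
  shows "tetrahedron {a, midpoint a b, c, d}"
proof -
  let ?C = "{a, midpoint a b, c, d}"
  have "b = (-1) *\<^sub>R a + 2 *\<^sub>R midpoint a b" by (simp add: midpoint_def algebra_simps)
  then have "b \<in> affine hull {a, midpoint a b}"
    unfolding affine_hull_2 by (intro CollectI exI[of _ "-1"] exI[of _ 2]) simp
  moreover have "affine hull {a, midpoint a b} \<subseteq> affine hull ?C" by (rule hull_mono) auto
  ultimately have "K \<subseteq> affine hull ?C"
    using assms(2) by (auto simp: labels_def intro: hull_inc)
  then have "3 \<le> aff_dim ?C"
    using aff_dim_subset[of K "affine hull ?C"] assms(1) by (simp add: tetrahedron_iff_aff_dim)
  moreover have "aff_dim ?C \<le> int (card ?C) - 1" by (rule aff_dim_le_card) simp
  moreover have "card ?C \<le> 4"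
    using card_length[of "[a, midpoint a b, c, d]"] by simp
  ultimately show ?thesis by (simp add: tetrahedron_iff_aff_dim)
qed

text \<open>A midpoint among the old vertices would have to be one of \<open>a\<close>,
  \<open>c\<close>, \<open>d\<close>, leaving the child with at most three points.\<close>

lemma midpoint_notin:
  assumes "tetrahedron K" "labels K e a b c d"
  shows "midpoint a b \<notin> K"
proof
  assume "midpoint a b \<in> K"
  moreover have "midpoint a b \<noteq> b" using assms(2) by (auto simp: labels_def)
  ultimately have "{a, midpoint a b, c, d} \<subseteq> {a, c, d}"
    using assms(2) by (auto simp: labels_def)
  then have "card {a, midpoint a b, c, d} \<le> card {a, c, d}" by (intro card_mono) auto
  also have "\<dots> \<le> 3" using card_length[of "[a, c, d]"] by simp
  finally show False using child_tetrahedron[OF assms] by (simp add: tetrahedron_def)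
qed

lemma child_hull:
  assumes "labels K e a b c d"
  shows "convex hull {a, midpoint a b, c, d} \<subseteq> convex hull K"
proof (rule hull_minimal)
  have "midpoint a b \<in> convex hull {a, b}" by (simp flip: segment_convex_hull)
  also have "\<dots> \<subseteq> convex hull K" using assms by (intro hull_mono) (auto simp: labels_def)
  finally show "{a, midpoint a b, c, d} \<subseteq> convex hull K"
    using assms by (auto simp: labels_def intro: hull_inc)
qed simp

text \<open>The plane through the bisection face separates the two children.\<close>

lemma children_interiors_disjoint:
  assumes "tetrahedron K" "labels K e a b c d"
  shows "interior (convex hull {a, midpoint a b, c, d}) \<inter>
    interior (convex hull {b, midpoint a b, c, d}) = {}"
proof -
  define z where "z = midpoint a b"
  have "dim {c - z, d - z} \<le> 2"
    using dim_le_card[of "{c - z, d - z}" "{c - z, d - z}"] card_length[of "[c - z, d - z]"]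
    by (simp add: span_superset)
  \<comment> \<open>A nonzero normal \<open>u\<close> of a plane through \<open>z\<close>,
    \<open>c\<close>, \<open>d\<close> exists for dimension reasons.\<close>
  then have "dim {c - z, d - z} < DIM(real^3)" by simp
  then obtain u where u: "u \<noteq> 0" "\<And>y. y \<in> span {c - z, d - z} \<Longrightarrow> orthogonal u y"
    using orthogonal_to_subspace_exists by blast
  have uc: "u \<bullet> c = u \<bullet> z" and ud: "u \<bullet> d = u \<bullet> z"
    using u(2)[of "c - z"] u(2)[of "d - z"]
    by (auto simp: orthogonal_def inner_diff_right span_base)
  have ab: "u \<bullet> a + u \<bullet> b = 2 * (u \<bullet> z)"
    by (simp add: z_def midpoint_def inner_add_right)
  have "u \<bullet> a \<noteq> u \<bullet> z"
  proof
    assume "u \<bullet> a = u \<bullet> z"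
    then have "K \<subseteq> {x. u \<bullet> x = u \<bullet> z}" using uc ud ab assms(2) by (auto simp: labels_def)
    then have "aff_dim K \<le> aff_dim {x. u \<bullet> x = u \<bullet> z}" by (rule aff_dim_subset)
    then show False using u(1) assms(1) by (simp add: tetrahedron_iff_aff_dim)
  qed
  \<comment> \<open>The sign of the normal is chosen so that \<open>a\<close> lies on the negative
    side; \<open>b\<close> is then on the positive side because \<open>z\<close> is the
    midpoint.\<close>
  then obtain v where v: "v \<noteq> 0" "v \<bullet> c = v \<bullet> z" "v \<bullet> d = v \<bullet> z" "v \<bullet> a < v \<bullet> z"
    using u(1) uc ud by (cases "u \<bullet> a < u \<bullet> z") (auto intro: that[of u] that[of "- u"])
  have vb: "v \<bullet> b > v \<bullet> z"
    using v(4) by (simp add: z_def midpoint_def inner_add_right)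
  have "convex hull {a, z, c, d} \<subseteq> {x. v \<bullet> x \<le> v \<bullet> z}"
    using v by (intro hull_minimal) (auto simp: convex_halfspace_le)
  then have "interior (convex hull {a, z, c, d}) \<subseteq> {x. v \<bullet> x < v \<bullet> z}"
    using interior_mono interior_halfspace_le[OF v(1)] by blast
  moreover have "convex hull {b, z, c, d} \<subseteq> {x. v \<bullet> x \<ge> v \<bullet> z}"
    using v vb by (intro hull_minimal) (auto simp: convex_halfspace_ge)
  then have "interior (convex hull {b, z, c, d}) \<subseteq> {x. v \<bullet> x > v \<bullet> z}"
    using interior_mono interior_halfspace_ge[OF v(1)] by blast
  ultimately show ?thesis unfolding z_def by fastforce
qed

text \<open>This is the geometric invariant at every boundary: it survives each bisection, whereas
  conformity may fail between the batches of a call.\<close>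

definition nonoverlapping :: "tet set \<Rightarrow> bool" where
  "nonoverlapping \<T> \<longleftrightarrow> (\<forall>K\<in>\<T>. tetrahedron K) \<and>
     (\<forall>K\<in>\<T>. \<forall>L\<in>\<T>. K \<noteq> L \<longrightarrow> interior (convex hull K) \<inter> interior (convex hull L) = {})"

text \<open>The nonempty interior of \<open>C\<close> would lie in two disjoint interiors. This
  identifies the element from which a given tetrahedron descends.\<close>

lemma nonoverlapping_container_unique:
  assumes "nonoverlapping \<T>" "K \<in> \<T>" "L \<in> \<T>" "tetrahedron C"
    "convex hull C \<subseteq> convex hull K" "convex hull C \<subseteq> convex hull L"
  shows "K = L"
proof (rule ccontr)
  assume "K \<noteq> L"
  then have "interior (convex hull K) \<inter> interior (convex hull L) = {}"
    using assms by (auto simp: nonoverlapping_def)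
  moreover have "interior (convex hull C) \<subseteq> interior (convex hull K) \<inter> interior (convex hull L)"
    using assms by (simp add: interior_mono)
  ultimately show False using tetrahedron_interior[OF assms(4)] by blast
qed

definition bisect :: "tet set \<Rightarrow> tet set \<Rightarrow> (tet \<Rightarrow> edge) \<Rightarrow> tet set" where
  "bisect \<T> S E = (\<T> - S) \<union> (\<Union>K\<in>S. child K (E K) ` E K)"

lemma child_properties:
  assumes "tetrahedron K" "e \<in> edges K" "x \<in> e"
  shows "tetrahedron (child K e x)" "convex hull (child K e x) \<subseteq> convex hull K"
    "child K e x \<noteq> K"
proof -
  obtain b c d where l: "labels K e x b c d"
    using labels_exist assms by (metis tetrahedron_def)
  show "tetrahedron (child K e x)" "convex hull (child K e x) \<subseteq> convex hull K"
    "child K e x \<noteq> K"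
    unfolding child_labels[OF l]
    using child_tetrahedron[OF assms(1) l] child_hull[OF l] midpoint_notin[OF assms(1) l] by auto
qed

lemma nonoverlapping_bisect:
  assumes "nonoverlapping \<T>" "S \<subseteq> \<T>" "\<And>K. K \<in> S \<Longrightarrow> E K \<in> edges K"
  shows "nonoverlapping (bisect \<T> S E)"
proof -
  have tet: "\<And>K. K \<in> \<T> \<Longrightarrow> tetrahedron K" using assms(1) by (simp add: nonoverlapping_def)
  \<comment> \<open>Each new element gets a containing old one, itself if it was not bisected.
    Distinct containers have disjoint interiors, and a common container leaves only its two children
    to be separated.\<close>
  have parent: "\<exists>P\<in>\<T>. tetrahedron C \<and> convex hull C \<subseteq> convex hull P \<and>
      (P \<notin> S \<and> C = P \<or> P \<in> S \<and> (\<exists>x\<in>E P. C = child P (E P) x))" if "C \<in> bisect \<T> S E" for C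
    using that unfolding bisect_def
  proof
    assume "C \<in> \<T> - S"
    then show ?thesis using tet by auto
  next
    assume "C \<in> (\<Union>K\<in>S. child K (E K) ` E K)"
    then obtain P x where P: "P \<in> S" "x \<in> E P" "C = child P (E P) x" by auto
    then have "P \<in> \<T>" using assms(2) by blast
    then show ?thesis
      using child_properties[OF tet assms(3)] P by (intro bexI[of _ P]) blast+
  qed
  have "interior (convex hull C) \<inter> interior (convex hull D) = {}"
    if CD: "C \<in> bisect \<T> S E" "D \<in> bisect \<T> S E" "C \<noteq> D" for C D
  proof -
    obtain P where P: "P \<in> \<T>" "convex hull C \<subseteq> convex hull P"
      "P \<notin> S \<and> C = P \<or> P \<in> S \<and> (\<exists>x\<in>E P. C = child P (E P) x)"
      using parent[OF CD(1)] by blast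
    obtain Q where Q: "Q \<in> \<T>" "convex hull D \<subseteq> convex hull Q"
      "Q \<notin> S \<and> D = Q \<or> Q \<in> S \<and> (\<exists>x\<in>E Q. D = child Q (E Q) x)"
      using parent[OF CD(2)] by blast
    show ?thesis
    proof (cases "P = Q")
      case False
      then have "interior (convex hull P) \<inter> interior (convex hull Q) = {}"
        using assms(1) P(1) Q(1) by (simp add: nonoverlapping_def)
      then show ?thesis using interior_mono[OF P(2)] interior_mono[OF Q(2)] by blast
    next
      case True
      then obtain x y where xy: "P \<in> S" "x \<in> E P" "C = child P (E P) x"
        "y \<in> E P" "D = child P (E P) y" using P(3) Q(3) CD(3) by auto
      obtain b c d where l: "labels P (E P) x b c d"
        using labels_exist tet[OF P(1)] assms(3)[OF xy(1)] xy(2) by (metis tetrahedron_def)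
      have "y = b" using xy CD(3) l by (auto simp: labels_def)
      then have "D = {b, midpoint x b, c, d}"
        using xy(5) child_labels[OF labels_swap_edge[OF l]] by (simp add: midpoint_sym)
      then show ?thesis
        using children_interiors_disjoint[OF tet[OF P(1)] l] xy(3) child_labels[OF l] by simp
    qed
  qed
  then show ?thesis unfolding nonoverlapping_def using parent by blast
qed

text \<open>A hanging vertex \<open>z\<close> of \<open>K\<close> is a vertex of some
  \<open>L\<close> and lies in the intersection of the hulls, which is the hull of common vertices.
  None of these is \<open>z\<close>, so \<open>z\<close> depends affinely on the other vertices of
  \<open>L\<close>. The lemma stops the AMP loop after a call with empty marking set.\<close>

lemma conforming_no_hanging:
  assumes "conforming \<T>" "\<And>K. K \<in> \<T> \<Longrightarrow> tetrahedron K"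
  shows "hanging_elements \<T> = {}"
proof (rule ccontr)
  assume "hanging_elements \<T> \<noteq> {}"
  then obtain K L z where z: "K \<in> \<T>" "L \<in> \<T>" "z \<in> L" "z \<in> frontier (convex hull K)" "z \<notin> K"
    unfolding hanging_elements_def by auto
  have "finite K" using assms(2)[OF z(1)] by (auto simp: tetrahedron_def intro: card_ge_0_finite)
  then have "closed (convex hull K)" by (simp add: finite_imp_compact_convex_hull compact_imp_closed)
  then have "z \<in> convex hull K" using z(4) frontier_subset_closed by blast
  then have zI: "z \<in> convex hull K \<inter> convex hull L" using z(3) by (simp add: hull_inc)
  have "K \<noteq> L" using z by auto
  then have "\<exists>A\<subseteq>K \<inter> L. convex hull K \<inter> convex hull L = convex hull A"
  proof -
    let ?I = "convex hull K \<inter> convex hull L"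
    have "?I = {} \<or> (\<exists>v\<in>K \<inter> L. ?I = {v}) \<or> (\<exists>e\<in>edges K \<inter> edges L. ?I = convex hull e) \<or>
        (\<exists>F\<in>faces K \<inter> faces L. ?I = convex hull F)"
      using assms(1) z(1,2) \<open>K \<noteq> L\<close> unfolding conforming_def Let_def by blast
    then show ?thesis
    proof (elim disjE bexE)
      fix v assume "v \<in> K \<inter> L" "?I = {v}"
      then show ?thesis by (intro exI[of _ "{v}"]) auto
    next
      fix e assume "e \<in> edges K \<inter> edges L" "?I = convex hull e"
      then show ?thesis by (intro exI[of _ e]) (auto simp: edges_def)
    next
      fix F assume "F \<in> faces K \<inter> faces L" "?I = convex hull F"
      then show ?thesis by (intro exI[of _ F]) (auto simp: faces_def)
    qed (use zI in simp)
  qed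
  then obtain A where A: "A \<subseteq> K \<inter> L" "convex hull K \<inter> convex hull L = convex hull A"
    by blast
  have "z \<in> affine hull A" using zI A(2) convex_hull_subset_affine_hull by blast
  also have "\<dots> \<subseteq> affine hull (L - {z})" using A(1) z(5) by (intro hull_mono) auto
  finally have "affine_dependent L" using z(3) by (auto simp: affine_dependent_def)
  then show False using assms(2)[OF z(2)] by (simp add: tetrahedron_def)
qed

section \<open>Marked tetrahedra\<close>

text \<open>Three vertices lie in a plane and all four do not, so coplanarity of marks reduces to
  the question whether they cover all vertices.\<close>

lemma coplanar_subset_tetrahedron:
  assumes "tetrahedron K" "A \<subseteq> K"
  shows "coplanar A \<longleftrightarrow> A \<noteq> K"
proof
  assume "coplanar A"
  then obtain u v w where "A \<subseteq> affine hull {u, v, w}" by (auto simp: coplanar_def)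
  then have "aff_dim A \<le> aff_dim {u, v, w}" 
    using aff_dim_subset[of A "affine hull {u, v, w}"] by simp
  also have "\<dots> \<le> int (card {u, v, w}) - 1" by (rule aff_dim_le_card) simp
  also have "\<dots> \<le> 2" using card_length[of "[u, v, w]"] by simp
  finally show "A \<noteq> K" using assms(1) by (auto simp: tetrahedron_iff_aff_dim)
next
  assume "A \<noteq> K"
  then obtain x where x: "x \<in> K" "A \<subseteq> K - {x}" using assms(2) by blast
  have "card (K - {x}) = 3" using x(1) assms(1) by (simp add: tetrahedron_def)
  then obtain u v w where "K - {x} = {u, v, w}" by (auto simp: card_3_iff)
  then have "A \<subseteq> affine hull {u, v, w}" using x(2) by (auto intro: hull_inc)
  then show "coplanar A" by (auto simp: coplanar_def)
qed

text \<open>The marks cover \<open>a\<close> and \<open>b\<close>, and each nonrefinement mark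
  contains \<open>c\<close> or \<open>d\<close>. A vertex is missed exactly if both contain the same
  single \<open>w\<close> of \<open>c\<close> and \<open>d\<close>, that is, if they are
  \<open>{a, w}\<close> and \<open>{b, w}\<close>.\<close>

lemma coplanar_marks_iff_black:
  assumes "tetrahedron (verts t)" "labels (verts t) (refedge t) a b c d"
    "mark t {a, b, c} = {a, b}" "mark t {a, b, d} = {a, b}"
    "mark t {a, c, d} \<in> {{a, c}, {a, d}, {c, d}}" "mark t {b, c, d} \<in> {{b, c}, {b, d}, {c, d}}"
  shows "coplanar_marks t \<longleftrightarrow> black (mark t) (verts t) (refedge t)"
proof -
  have l: "verts t = {a, b, c, d}" "distinct [a, b, c, d]" using assms(2) by (auto simp: labels_def)
  have U: "(\<Union>F\<in>faces (verts t). mark t F) = {a, b} \<union> mark t {a, c, d} \<union> mark t {b, c, d}"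
    unfolding faces_labels[OF assms(2)] using assms(3,4) by auto
  have "coplanar_marks t \<longleftrightarrow> {a, b} \<union> mark t {a, c, d} \<union> mark t {b, c, d} \<noteq> verts t"
    unfolding coplanar_marks_def U using assms(1,5,6) l
    by (intro coplanar_subset_tetrahedron) auto
  also have "\<dots> \<longleftrightarrow> black (mark t) (verts t) (refedge t)"
    unfolding black_labels[OF assms(2)] using assms(5,6) l
    by (elim insertE emptyE) (auto simp: doubleton_eq_iff)
  finally show ?thesis .
qed

lemma marked_tetrahedron_labels:
  assumes "labels (verts t) (refedge t) a b c d"
  shows "marked_tetrahedron t \<longleftrightarrow> tetrahedron (verts t) \<and>
    mark t {a, b, c} = {a, b} \<and> mark t {a, b, d} = {a, b} \<and>
    mark t {a, c, d} \<in> {{a, c}, {a, d}, {c, d}} \<and> mark t {b, c, d} \<in> {{b, c}, {b, d}, {c, d}} \<and>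
    (flag t \<longrightarrow> black (mark t) (verts t) (refedge t))"
proof -
  have l: "verts t = {a, b, c, d}" "refedge t = {a, b}" "distinct [a, b, c, d]"
    using assms by (auto simp: labels_def)
  define Y where "Y \<longleftrightarrow>
    mark t {a, b, c} = {a, b} \<and> mark t {a, b, d} = {a, b} \<and>
    mark t {a, c, d} \<in> {{a, c}, {a, d}, {c, d}} \<and> mark t {b, c, d} \<in> {{b, c}, {b, d}, {c, d}}"
  have "(\<forall>F\<in>faces (verts t). mark t F \<in> edges F \<and> (refedge t \<subseteq> F \<longrightarrow> mark t F = refedge t)) \<longleftrightarrow> Y"
  proof -
    have sub: "{a, b} \<subseteq> {a, b, c}" "{a, b} \<subseteq> {a, b, d}" "\<not> {a, b} \<subseteq> {a, c, d}" "\<not> {a, b} \<subseteq> {b, c, d}"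
      using l(3) by auto
    have dist: "distinct [a, b, c]" "distinct [a, b, d]" "distinct [a, c, d]" "distinct [b, c, d]"
      using l(3) by auto
    \<comment> \<open>On the two faces through the refinement edge, the prescribed mark is itself an
      edge of the face, which absorbs the membership condition.\<close>
    have ref: "(x \<in> insert e A \<and> (P \<longrightarrow> x = e)) = (x = e)" if P for P and x e :: edge and A
      using that by blast
    show ?thesis
      unfolding faces_labels[OF assms] l(2) ball_simps dist[THEN edges_triangle] Y_def
      by (simp only: ref[OF sub(1)] ref[OF sub(2)] sub(3,4) simp_thms)
  qed
  moreover have "refedge t \<in> edges (verts t)" using l by (simp add: edges_def)
  moreover have "coplanar_marks t \<longleftrightarrow> black (mark t) (verts t) (refedge t)" if "tetrahedron (verts t)" Y
    using coplanar_marks_iff_black[OF that(1) assms] that(2) unfolding Y_def by simp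
  ultimately have "marked_tetrahedron t \<longleftrightarrow> tetrahedron (verts t) \<and> Y \<and>
    (flag t \<longrightarrow> black (mark t) (verts t) (refedge t))"
    unfolding marked_tetrahedron_def by blast
  then show ?thesis unfolding Y_def by simp
qed

lemma black_cong:
  assumes "\<And>F. F \<in> faces K \<Longrightarrow> \<mu> F = \<nu> F"
  shows "black \<mu> K e \<longleftrightarrow> black \<nu> K e"
  unfolding black_def using assms faces_labels by (smt (verit) insertI1 insertI2)

text \<open>
  The invariant of the simulation. The remaining correspondence of states is a consequence: the five
  configurations are determined by the face marks, apart from \<open>\<epsilon>\<close> and the flag.
\<close>

definition represents :: "bmesh \<Rightarrow> mtet \<Rightarrow> bool" where
  "represents B t \<longleftrightarrow> marked_tetrahedron t \<and> (\<forall>F\<in>faces (verts t). mark t F = fmark B F) \<and>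
     (eps B (verts t) \<longleftrightarrow> flag t)"

text \<open>A nonrefinement mark avoids the refinement edge iff it equals \<open>{c, d}\<close>. The
  number of such marks separates the cases: two give \<open>O\<close>, one gives \<open>M\<close>,
  and with none the tetrahedron is red or black, of which black is coplanarity and is split by the
  flag.\<close>

lemma represents_corresponding:
  assumes "represents B t"
  shows "corresponding B t"
proof -
  have t: "marked_tetrahedron t" "\<And>F. F \<in> faces (verts t) \<Longrightarrow> mark t F = fmark B F"
    "eps B (verts t) \<longleftrightarrow> flag t" using assms by (auto simp: represents_def)
  have "card (verts t) = 4" "refedge t \<in> edges (verts t)"
    using t(1) by (auto simp: marked_tetrahedron_def tetrahedron_def)
  moreover from this obtain x where "x \<in> refedge t" by (auto simp: edges_def card_2_iff)
  ultimately obtain a b c d where l: "labels (verts t) (refedge t) a b c d" using labels_exist by metis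
  have d: "distinct [a, b, c, d]" "refedge t = {a, b}" using l by (auto simp: labels_def)
  note fl = faces_labels[OF l]
  have m: "tetrahedron (verts t)" "mark t {a, b, c} = {a, b}" "mark t {a, b, d} = {a, b}"
    "mark t {a, c, d} \<in> {{a, c}, {a, d}, {c, d}}" "mark t {b, c, d} \<in> {{b, c}, {b, d}, {c, d}}"
    using t(1) marked_tetrahedron_labels[OF l] by auto
  have fm: "fmark B {a, b, c} = {a, b}" "fmark B {a, b, d} = {a, b}"
    "fmark B {a, c, d} = mark t {a, c, d}" "fmark B {b, c, d} = mark t {b, c, d}"
    using t(2) m unfolding fl by auto
  have g: "refedge t \<in> gedges (fmark B) (verts t)"
    unfolding gedges_labels[OF l] using fm d by simp
  have cop: "coplanar_marks t \<longleftrightarrow> black (fmark B) (verts t) (refedge t)"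
    using coplanar_marks_iff_black[OF m(1) l m(2-)] black_cong[of "verts t" "mark t"] t(2) by blast
  have nr: "nonref_faces t = {{a, c, d}, {b, c, d}}"
    unfolding nonref_faces_def fl using d by auto
  have ne: "{a, c, d} \<noteq> {b, c, d}" using d(1) by auto
  have meet: "mark t {a, c, d} \<inter> refedge t = {} \<longleftrightarrow> mark t {a, c, d} = {c, d}"
    "mark t {b, c, d} \<inter> refedge t = {} \<longleftrightarrow> mark t {b, c, d} = {c, d}"
  proof -
    have *: "X \<inter> refedge t = {} \<longleftrightarrow> X = {c, d}" if "X = {y, c} \<or> X = {y, d} \<or> X = {c, d}" "y \<in> {a, b}" for X y
      using that d by (elim disjE) (auto simp: doubleton_eq_iff)
    then show "mark t {a, c, d} \<inter> refedge t = {} \<longleftrightarrow> mark t {a, c, d} = {c, d}"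
      "mark t {b, c, d} \<inter> refedge t = {} \<longleftrightarrow> mark t {b, c, d} = {c, d}"
      using m(4,5) by (intro *[of _ a] *[of _ b]; simp only: insert_iff empty_iff simp_thms)+
  qed
  have A: "type_A t \<longleftrightarrow> mark t {a, c, d} \<noteq> {c, d} \<and> mark t {b, c, d} \<noteq> {c, d} \<and> \<not> coplanar_marks t"
    unfolding type_A_def nr ball_simps meet by simp
  have M: "type_M t \<longleftrightarrow> (mark t {a, c, d} = {c, d}) \<noteq> (mark t {b, c, d} = {c, d})"
  proof -
    have "(\<exists>!F. F \<in> {G, H} \<and> Q F) \<longleftrightarrow> Q G \<noteq> Q H" if "G \<noteq> H" for G H :: face and Q
      using that by auto
    from this[OF ne] show ?thesis unfolding type_M_def nr by (simp only: meet) argo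
  qed
  have O: "type_O t \<longleftrightarrow> mark t {a, c, d} = {c, d} \<and> mark t {b, c, d} = {c, d}"
    unfolding type_O_def nr ball_simps meet by simp
  have ne': "{c, d} \<noteq> {a, w}" "{c, d} \<noteq> {b, w}" for w using d(1) by auto
  have N: "\<not> red (fmark B) (verts t) (refedge t) \<and> \<not> black (fmark B) (verts t) (refedge t)"
    if "mark t {a, c, d} = {c, d} \<or> mark t {b, c, d} = {c, d}"
    unfolding red_labels[OF l] black_labels[OF l] fm(3,4) using that
    by (elim disjE) (simp_all only: ne' simp_thms bex_simps)
  have U1: "unnamed_one (fmark B) (verts t) (refedge t)"
    if "(mark t {a, c, d} = {c, d}) \<noteq> (mark t {b, c, d} = {c, d})"
  proof -
    have "mark t {a, c, d} = {c, d} \<or> mark t {b, c, d} = {c, d}" using that by argo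
    from N[OF this] show ?thesis
      unfolding unnamed_one_def using that l fm(3,4)
      by (intro conjI exI[of _ a] exI[of _ b] exI[of _ c] exI[of _ d]) simp_all
  qed
  have U2: "unnamed_both (fmark B) (verts t) (refedge t)"
    if "mark t {a, c, d} = {c, d} \<and> mark t {b, c, d} = {c, d}"
    unfolding unnamed_both_def using that N l fm(3,4)
    by (intro conjI exI[of _ a] exI[of _ b] exI[of _ c] exI[of _ d]) simp_all
  have R: "mark t {a, c, d} \<noteq> {c, d} \<Longrightarrow> mark t {b, c, d} \<noteq> {c, d} \<Longrightarrow>
      red (fmark B) (verts t) (refedge t) \<or> black (fmark B) (verts t) (refedge t)"
    unfolding red_labels[OF l] black_labels[OF l] fm(3,4) using m(4,5) by auto
  show ?thesis
    unfolding corresponding_def Let_def type_Pu_def type_Pf_def A M O cop t(3)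
    using g U1 U2 R by argo
qed

lemma black_THE_labels:
  assumes "distinct [a, b, c, d]" "\<mu> {a, c, d} = {a, c}" "\<mu> {b, c, d} = {b, c}"
  shows "(THE w. w \<in> {c, d} \<and> \<mu> {a, c, d} = {a, w} \<and> \<mu> {b, c, d} = {b, w}) = c"
  using assms by (intro the_equality) (auto simp: doubleton_eq_iff)

text \<open>
  Here \<open>r\<close> is the refinement edge of the child retaining \<open>a\<close> and \<open>f\<close> the flag of its parent; exchanging
  \<open>c\<close> and \<open>d\<close> excludes \<open>r = {a, d}\<close>. The second claim covers the children of flagged parents, for
  which rule (R4) quantifies over all global refinement edges.
\<close>

lemma child_marks_black:
  fixes \<mu> :: "face \<Rightarrow> edge"
  assumes "distinct [a, z, c, d]"
    and "\<mu> {a, z, c} = {a, c}" "\<mu> {a, z, d} = {a, d}" "\<mu> {a, c, d} = r"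
    and "r = {a, c} \<and> \<mu> {z, c, d} = (if f then {z, c} else {c, d}) \<or>
      r = {c, d} \<and> \<mu> {z, c, d} = {c, d} \<and> \<not> f"
  shows "black \<mu> {a, z, c, d} r \<longleftrightarrow> \<not> f"
    "\<And>e. e \<in> gedges \<mu> {a, z, c, d} \<Longrightarrow> black \<mu> {a, z, c, d} e \<Longrightarrow> \<not> f"
    "r \<in> gedges \<mu> {a, z, c, d}"
    "\<exists>p q u v. labels {a, z, c, d} r p q u v \<and> \<mu> {p, q, u} = {p, q} \<and> \<mu> {p, q, v} = {p, q} \<and>
      \<mu> {p, u, v} \<in> {{p, u}, {p, v}, {u, v}} \<and> \<mu> {q, u, v} \<in> {{q, u}, {q, v}, {u, v}}"
proof -
  have perm: "{c, d, a} = {a, c, d}" "{c, d, z} = {z, c, d}" "{c, a, z} = {a, z, c}"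
    "{d, a, z} = {a, z, d}" "{a, c, z} = {a, z, c}" "{c, z, d} = {z, c, d}" by auto
  have "(black \<mu> {a, z, c, d} r \<longleftrightarrow> \<not> f) \<and>
    (\<forall>e. e \<in> gedges \<mu> {a, z, c, d} \<longrightarrow> black \<mu> {a, z, c, d} e \<longrightarrow> \<not> f) \<and>
    r \<in> gedges \<mu> {a, z, c, d} \<and>
    (\<exists>p q u v. labels {a, z, c, d} r p q u v \<and> \<mu> {p, q, u} = {p, q} \<and> \<mu> {p, q, v} = {p, q} \<and>
      \<mu> {p, u, v} \<in> {{p, u}, {p, v}, {u, v}} \<and> \<mu> {q, u, v} \<in> {{q, u}, {q, v}, {u, v}})"
    using assms(5)
  proof
    assume r: "r = {a, c} \<and> \<mu> {z, c, d} = (if f then {z, c} else {c, d})"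
    have l: "labels {a, z, c, d} r a c z d" using assms(1) r by (auto simp: labels_def)
    have g: "r \<in> gedges \<mu> {a, z, c, d}"
      unfolding gedges_labels[OF l] perm using assms r by simp
    have b: "black \<mu> {a, z, c, d} r \<longleftrightarrow> \<not> f"
      unfolding black_labels[OF l] perm using assms(1,3) r by (auto simp: doubleton_eq_iff)
    have "\<not> f" if e: "e \<in> gedges \<mu> {a, z, c, d}" "black \<mu> {a, z, c, d} e" for e
    proof (cases "e = r")
      \<comment> \<open>The only competitor of \<open>r\<close> is the opposite edge
        \<open>{z, d}\<close>; it would have to be the mark of the cut face
        \<open>{a, z, d}\<close>, which is \<open>{a, d}\<close>.\<close>
      case False
      then have "e = {z, d}" using gedges_opposite[OF l g e(1)] by blast
      then have "\<mu> {a, z, d} = {z, d}"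
        using e(1) unfolding gedges_def faces_labels[OF l] by (auto simp: perm)
      then show ?thesis using assms(1,3) by (auto simp: doubleton_eq_iff)
    qed (use b e in auto)
    moreover have "\<mu> {a, c, z} = {a, c} \<and> \<mu> {a, c, d} = {a, c} \<and>
      \<mu> {a, z, d} \<in> {{a, z}, {a, d}, {z, d}} \<and> \<mu> {c, z, d} \<in> {{c, z}, {c, d}, {z, d}}"
      unfolding perm using assms r by (auto simp: insert_commute)
    ultimately show ?thesis using l g b by blast
  next
    assume r: "r = {c, d} \<and> \<mu> {z, c, d} = {c, d} \<and> \<not> f"
    have l: "labels {a, z, c, d} r c d a z" using assms(1) r by (auto simp: labels_def)
    have g: "r \<in> gedges \<mu> {a, z, c, d}"
      unfolding gedges_labels[OF l] perm using assms r by simp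
    have b: "black \<mu> {a, z, c, d} r"
      unfolding black_labels[OF l] perm using assms by (auto simp: insert_commute)
    moreover have "\<mu> {c, d, a} = {c, d} \<and> \<mu> {c, d, z} = {c, d} \<and>
      \<mu> {c, a, z} \<in> {{c, a}, {c, z}, {a, z}} \<and> \<mu> {d, a, z} \<in> {{d, a}, {d, z}, {a, z}}"
      unfolding perm using assms r by (auto simp: insert_commute)
    ultimately show ?thesis using r l g by blast
  qed
  then show "black \<mu> {a, z, c, d} r \<longleftrightarrow> \<not> f"
    "\<And>e. e \<in> gedges \<mu> {a, z, c, d} \<Longrightarrow> black \<mu> {a, z, c, d} e \<Longrightarrow> \<not> f"
    "r \<in> gedges \<mu> {a, z, c, d}"
    "\<exists>p q u v. labels {a, z, c, d} r p q u v \<and> \<mu> {p, q, u} = {p, q} \<and> \<mu> {p, q, v} = {p, q} \<and>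
      \<mu> {p, u, v} \<in> {{p, u}, {p, v}, {u, v}} \<and> \<mu> {q, u, v} \<in> {{q, u}, {q, v}, {u, v}}"
    by blast+
qed

lemma represents_child:
  assumes "represents B t" "bansch_batch B S E B'" "verts t \<in> S" "E (verts t) = refedge t"
    "x \<in> refedge t"
  shows "represents B' (amp_child t x)"
proof -
  let ?\<mu> = "fmark B" and ?\<mu>' = "fmark B'"
  have t: "marked_tetrahedron t" "\<And>F. F \<in> faces (verts t) \<Longrightarrow> mark t F = ?\<mu> F"
    "eps B (verts t) \<longleftrightarrow> flag t" using assms(1) by (auto simp: represents_def)
  have tet: "tetrahedron (verts t)" "refedge t \<in> edges (verts t)"
    using t(1) by (auto simp: marked_tetrahedron_def)
  then obtain b c0 d0 where l0: "labels (verts t) (refedge t) x b c0 d0"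
    using labels_exist assms(5) by (metis tetrahedron_def)
  \<comment> \<open>Exchanging \<open>c\<close> and \<open>d\<close> if necessary removes the
    inherited mark \<open>{x, d}\<close>. For a flagged parent this normalisation makes
    \<open>c\<close> the common endpoint \<open>w\<close> in both rules for the new face.\<close>
  have "\<exists>c d. labels (verts t) (refedge t) x b c d \<and> mark t {x, c, d} \<in> {{x, c}, {c, d}}"
  proof (cases "mark t {x, c0, d0} = {x, d0}")
    case True
    then have "mark t {x, d0, c0} = {x, d0}" by (simp add: insert_commute)
    then show ?thesis using labels_swap_rest[OF l0] by blast
  next
    case False
    then show ?thesis using l0 t(1) marked_tetrahedron_labels[OF l0] by blast
  qed
  then obtain c d where l: "labels (verts t) (refedge t) x b c d"
    and r: "mark t {x, c, d} \<in> {{x, c}, {c, d}}" by blast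
  have v: "verts t = {x, b, c, d}" "refedge t = {x, b}" "distinct [x, b, c, d]"
    using l by (auto simp: labels_def)
  define z where "z = midpoint x b"
  have z: "z \<notin> {x, b, c, d}" using midpoint_notin[OF tet(1) l] v(1) by (simp add: z_def)
  note fl = faces_labels[OF l]
  have m: "mark t {x, b, c} = {x, b}" "mark t {x, b, d} = {x, b}"
    "mark t {b, c, d} \<in> {{b, c}, {b, d}, {c, d}}"
    "mark t {x, c, d} \<in> {{x, c}, {x, d}, {c, d}}"
    "flag t \<Longrightarrow> black (mark t) (verts t) (refedge t)"
    using t(1) marked_tetrahedron_labels[OF l] by auto
  have fm: "?\<mu> {x, c, d} = mark t {x, c, d}" "?\<mu> {b, c, d} = mark t {b, c, d}"
    using t(2) unfolding fl by auto
  have cop: "coplanar_marks t \<longleftrightarrow> black (mark t) (verts t) (refedge t)"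
    using coplanar_marks_iff_black[OF tet(1) l m(1,2,4,3)] .
  have bl: "black ?\<mu> (verts t) (refedge t) \<longleftrightarrow> black (mark t) (verts t) (refedge t)"
    by (rule black_cong) (simp add: t(2))
  have Pf: "type_Pf t \<longleftrightarrow> flag t" unfolding type_Pf_def cop using m(5) by blast
  have fr: "mark t {x, c, d} = {x, c} \<and> mark t {b, c, d} = {b, c}" if "flag t"
    using m(5)[OF that] r v(3) unfolding black_labels[OF l] by (auto simp: doubleton_eq_iff)

  let ?C = "{x, z, c, d}" and ?s = "amp_child t x"
  have Kx: "verts t - (refedge t - {x}) = {x, c, d}" "verts t - (refedge t - {b}) = {b, c, d}"
    "insert (mid (refedge t)) (verts t - refedge t) = {z, c, d}" "verts t - refedge t = {c, d}"
    using v z_def by auto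
  have vs: "verts ?s = ?C" using child_labels[OF l] by (simp add: amp_child_def Let_def z_def)
  have rs: "refedge ?s = mark t {x, c, d}" by (simp add: amp_child_def Let_def Kx)
  have fs: "flag ?s \<longleftrightarrow> black (mark t) (verts t) (refedge t) \<and> \<not> flag t"
    by (simp add: amp_child_def Let_def type_Pu_def cop)
  have zne: "z \<noteq> x" "z \<noteq> b" "z \<noteq> c" "z \<noteq> d" using z by auto
  have midz: "mid (refedge t) = z" by (simp add: v(2) z_def)
  have ms: "mark ?s = (\<lambda>F. if F = {x, c, d} then mark t F
      else if F = {z, c, d} then
        (if flag t then {z, THE w. w \<in> {c, d} \<and> (\<forall>y\<in>refedge t. w \<in> mark t (verts t - (refedge t - {y})))}
         else {c, d})
      else F - {z})"
    unfolding amp_child_def Let_def Kx Pf midz by simp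
  have "{x, z, c} \<noteq> {x, c, d}" "{x, z, d} \<noteq> {x, c, d}" "{x, z, c} \<noteq> {z, c, d}"
    "{x, z, d} \<noteq> {z, c, d}" "{z, c, d} \<noteq> {x, c, d}" using v(3) zne by auto
  then have s1: "mark ?s {x, c, d} = mark t {x, c, d}" "mark ?s {x, z, c} = {x, c}"
    "mark ?s {x, z, d} = {x, d}" unfolding ms using v(3) zne by auto
  have s2: "mark ?s {z, c, d} = (if flag t then {z, c} else {c, d})"
  proof (cases "flag t")
    case True
    have "(THE w. w \<in> {c, d} \<and> (\<forall>y\<in>refedge t. w \<in> mark t (verts t - (refedge t - {y})))) = c"
      using fr[OF True] v(3) unfolding v(2) ball_simps Kx[unfolded v(2)]
      by (intro the_equality) auto
    then show ?thesis unfolding ms using \<open>{z, c, d} \<noteq> {x, c, d}\<close> True by simp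
  next
    case False
    then show ?thesis unfolding ms using \<open>{z, c, d} \<noteq> {x, c, d}\<close> by simp
  qed
  have rule: "?\<mu>' {p, u, w} = ?\<mu> {p, u, w} \<and> ?\<mu>' {p, z, u} = {p, u} \<and>
      ?\<mu>' {z, u, w} = (if flag t
        then {z, THE y. y \<in> {u, w} \<and> ?\<mu> {p, u, w} = {p, y} \<and> ?\<mu> {q, u, w} = {q, y}} else {u, w})"
    if "labels (verts t) (refedge t) p q u w" for p q u w
  proof -
    have "mid {p, q} = z" using that midz by (simp add: labels_def)
    have "\<forall>a b c d. labels (verts t) (E (verts t)) a b c d \<longrightarrow>
         ?\<mu>' {a, c, d} = ?\<mu> {a, c, d} \<and> ?\<mu>' {a, mid {a, b}, c} = {a, c} \<and>
         ?\<mu>' {mid {a, b}, c, d} = (if eps B (verts t)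
            then {mid {a, b}, THE w. w \<in> {c, d} \<and> ?\<mu> {a, c, d} = {a, w} \<and> ?\<mu> {b, c, d} = {b, w}}
            else {c, d})"
      using assms(2,3) unfolding bansch_batch_def Let_def by blast
    from this[rule_format, of p q u w] that show ?thesis
      unfolding assms(4) t(3) \<open>mid {p, q} = z\<close> by (simp only: simp_thms)
  qed
  have b1: "?\<mu>' {x, c, d} = mark t {x, c, d}" "?\<mu>' {x, z, c} = {x, c}" "?\<mu>' {x, z, d} = {x, d}"
    using rule[OF l] rule[OF labels_swap_rest[OF l]] fm(1) by auto
  have b2: "?\<mu>' {z, c, d} = (if flag t then {z, c} else {c, d})"
    using rule[OF l] fr fm black_THE_labels[OF v(3), of ?\<mu>] by simp
  have dC: "distinct [x, z, c, d]" using v(3) zne by auto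
  have key: "mark t {x, c, d} = {x, c} \<and> \<nu> {z, c, d} = (if flag t then {z, c} else {c, d}) \<or>
      mark t {x, c, d} = {c, d} \<and> \<nu> {z, c, d} = {c, d} \<and> \<not> flag t"
    if "\<nu> {z, c, d} = (if flag t then {z, c} else {c, d})" for \<nu> :: "face \<Rightarrow> edge"
    using that r fr v(3) by (auto simp: doubleton_eq_iff)
  \<comment> \<open>The same computation is used for both sides: the AMP marks show that the child
    is a marked tetrahedron, the Baensch marks determine its state through (R4).\<close>
  note S = child_marks_black[OF dC s1(2,3,1) key[of "mark ?s", OF s2]]
  note N = child_marks_black[OF dC b1(2,3,1) key[of ?\<mu>', OF b2]]
  have fC: "faces ?C = {{x, z, c}, {x, z, d}, {x, c, d}, {z, c, d}}"
    by (rule faces_labels[of _ "{x, z}"]) (use dC in \<open>simp add: labels_def\<close>)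
  obtain p q u w where pl: "labels (verts ?s) (refedge ?s) p q u w"
    and pm: "mark ?s {p, q, u} = {p, q} \<and> mark ?s {p, q, w} = {p, q} \<and>
      mark ?s {p, u, w} \<in> {{p, u}, {p, w}, {u, w}} \<and> mark ?s {q, u, w} \<in> {{q, u}, {q, w}, {u, w}}"
    using S(4) unfolding vs rs by blast
  have "tetrahedron ?C" using child_tetrahedron[OF tet(1) l] by (simp add: z_def)
  then have "marked_tetrahedron ?s"
    unfolding marked_tetrahedron_labels[OF pl] using pm S(1) fs by (simp add: vs rs)
  moreover have "\<forall>F\<in>faces (verts ?s). mark ?s F = ?\<mu>' F"
    unfolding vs fC using s1 s2 b1 b2 by simp
  moreover have "eps B' (verts ?s) \<longleftrightarrow> flag ?s"
  proof -
    have "verts ?s \<in> child (verts t) (E (verts t)) ` E (verts t)"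
      using assms(4,5) by (auto simp: amp_child_def Let_def)
    then have "eps B' (verts ?s) \<longleftrightarrow> black ?\<mu> (verts t) (refedge t) \<and>
        (\<exists>e\<in>gedges ?\<mu>' (verts ?s). black ?\<mu>' (verts ?s) e)"
      using assms(2,3) unfolding bansch_batch_def Let_def assms(4)[symmetric] by blast
    then show ?thesis unfolding fs bl vs using N(1-3) by blast
  qed
  ultimately show ?thesis by (simp add: represents_def)
qed


section \<open>Batches\<close>

definition represents_mesh :: "bmesh \<Rightarrow> mtet set \<Rightarrow> bool" where
  "represents_mesh B T \<longleftrightarrow> verts ` T = tets B \<and> inj_on verts T \<and> (\<forall>t\<in>T. represents B t)"

lemma represents_mesh_matching: "represents_mesh B T \<Longrightarrow> matching B T"
  unfolding represents_mesh_def matching_def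
  using represents_corresponding by (auto simp: represents_def)

lemma verts_amp_child: "verts (amp_child t x) = child (verts t) (refedge t) x"
  by (simp add: amp_child_def Let_def)

lemma tets_bansch_batch: "bansch_batch B S E B' \<Longrightarrow> tets B' = bisect (tets B) S E"
  by (simp add: bansch_batch_def bisect_def Let_def)

text \<open>The child keeping one endpoint has lost the other, and the midpoint differs from
  both.\<close>

lemma child_inj:
  assumes "tetrahedron K" "e \<in> edges K" "x \<in> e" "y \<in> e" "child K e x = child K e y"
  shows "x = y"
proof (rule ccontr)
  assume "x \<noteq> y"
  obtain b c d where l: "labels K e x b c d"
    using labels_exist assms(1-3) by (metis tetrahedron_def)
  have "y = b" using l assms(4) \<open>x \<noteq> y\<close> by (auto simp: labels_def)
  then have "child K e y = {b, midpoint x b, c, d}"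
    using child_labels[OF labels_swap_edge[OF l]] by (simp add: midpoint_sym)
  then have "x \<in> {b, midpoint x b, c, d}" using assms(5) child_labels[OF l] by auto
  moreover have "distinct [x, b, c, d]" using l by (simp add: labels_def)
  moreover from this have "x \<noteq> midpoint x b" by (simp add: eq_commute[of x])
  ultimately show False by auto
qed

text \<open>A child in the family would have to be \<open>L\<close>, since both contain it. Then
  \<open>K\<close> is squeezed between the child and \<open>L\<close>, so the child would equal
  \<open>K\<close>. Applied to the initial mesh, this says that bisection never recreates an initial
  tetrahedron.\<close>

lemma child_notin:
  assumes "nonoverlapping \<T>" "L \<in> \<T>" "convex hull K \<subseteq> convex hull L"
    "tetrahedron K" "e \<in> edges K" "x \<in> e"
  shows "child K e x \<notin> \<T>"
proof
  assume C: "child K e x \<in> \<T>"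
  note c = child_properties[OF assms(4-6)]
  have "child K e x = L"
    using nonoverlapping_container_unique[OF assms(1) C assms(2) c(1)] c(2) assms(3) by auto
  then have "convex hull (child K e x) = convex hull K" using c(2) assms(3) by auto
  then show False using tetrahedron_hull_eq[OF c(1) assms(4)] c(3) by blast
qed

lemma represents_mesh_batch:
  assumes "represents_mesh B T" "nonoverlapping (tets B)" "bansch_batch B S E B'"
    "S \<subseteq> tets B" "\<And>t. t \<in> T \<Longrightarrow> verts t \<in> S \<Longrightarrow> E (verts t) = refedge t"
  shows "represents_mesh B' (amp_batch T S)"
proof -
  have T: "verts ` T = tets B" "inj_on verts T" "\<And>t. t \<in> T \<Longrightarrow> represents B t"
    using assms(1) by (auto simp: represents_mesh_def)
  have tet: "tetrahedron (verts t)" "refedge t \<in> edges (verts t)" if "t \<in> T" for t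
    using T(3)[OF that] by (auto simp: represents_def marked_tetrahedron_def)
  have parent: "\<exists>t\<in>T. tetrahedron (verts s) \<and> convex hull (verts s) \<subseteq> convex hull (verts t) \<and>
      (verts t \<notin> S \<and> s = t \<or> verts t \<in> S \<and> (\<exists>x\<in>refedge t. s = amp_child t x))"
    if "s \<in> amp_batch T S" for s
    using that unfolding amp_batch_def
  proof
    assume "s \<in> {t \<in> T. verts t \<notin> S}"
    then show ?thesis using tet(1) by auto
  next
    assume "s \<in> (\<Union>t\<in>{t \<in> T. verts t \<in> S}. amp_child t ` refedge t)"
    then obtain t x where t: "t \<in> T" "verts t \<in> S" "x \<in> refedge t" "s = amp_child t x" by auto
    then show ?thesis
      using child_properties[OF tet[OF t(1)] t(3)]
      by (intro bexI[of _ t]) (auto simp only: verts_amp_child)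
  qed
  have "verts ` amp_batch T S = (verts ` T - S) \<union>
      (\<Union>t\<in>{t \<in> T. verts t \<in> S}. child (verts t) (E (verts t)) ` E (verts t))"
    unfolding amp_batch_def image_Un image_UN image_image verts_amp_child
    using assms(5) by (intro arg_cong2[where f = "(\<union>)"]) auto
  also have "\<dots> = (tets B - S) \<union> (\<Union>K\<in>S. child K (E K) ` E K)"
  proof -
    have "S = verts ` {t \<in> T. verts t \<in> S}" using assms(4) unfolding T(1)[symmetric] by auto
    then have "(\<Union>t\<in>{t \<in> T. verts t \<in> S}. child (verts t) (E (verts t)) ` E (verts t)) =
        (\<Union>K\<in>S. child K (E K) ` E K)"
      by (metis (no_types, lifting) SUP_cong UN_simps(10))
    then show ?thesis using T(1) by simp
  qed
  finally have "verts ` amp_batch T S = tets B'"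
    using tets_bansch_batch[OF assms(3)] by (simp add: bisect_def)
  moreover have "inj_on verts (amp_batch T S)"
  proof (rule inj_onI)
    fix s s' assume s: "s \<in> amp_batch T S" "s' \<in> amp_batch T S" "verts s = verts s'"
    obtain t where t: "t \<in> T" "tetrahedron (verts s)" "convex hull (verts s) \<subseteq> convex hull (verts t)"
      "verts t \<notin> S \<and> s = t \<or> verts t \<in> S \<and> (\<exists>x\<in>refedge t. s = amp_child t x)"
      using parent[OF s(1)] by blast
    obtain t' where t': "t' \<in> T" "convex hull (verts s) \<subseteq> convex hull (verts t')"
      "verts t' \<notin> S \<and> s' = t' \<or> verts t' \<in> S \<and> (\<exists>x\<in>refedge t'. s' = amp_child t' x)"
      using parent[OF s(2)] s(3) by auto
    \<comment> \<open>Both containers hold the same nondegenerate tetrahedron, so they coincide;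
      equal children of one parent then keep the same endpoint.\<close>
    have "verts t = verts t'"
      using nonoverlapping_container_unique[OF assms(2) _ _ t(2,3) t'(2)] t(1) t'(1) T(1) by blast
    then have "t = t'" using T(2) t(1) t'(1) by (auto dest: inj_onD)
    then show "s = s'"
      using t(4) t'(3) s(3) child_inj[OF tet[OF t(1)]] by (metis verts_amp_child)
  qed
  moreover have "represents B' s" if "s \<in> amp_batch T S" for s
    using that unfolding amp_batch_def
  proof
    assume s: "s \<in> {t \<in> T. verts t \<notin> S}"
    then have "verts s \<in> tets B - S" using T(1) by auto
    then have "\<And>F. F \<in> faces (verts s) \<Longrightarrow> fmark B' F = fmark B F" "eps B' (verts s) = eps B (verts s)"
      using assms(3) unfolding bansch_batch_def Let_def by blast+
    then show ?thesis using T(3)[of s] s by (simp add: represents_def)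
  next
    assume "s \<in> (\<Union>t\<in>{t \<in> T. verts t \<in> S}. amp_child t ` refedge t)"
    then show ?thesis using represents_child[OF T(3) assms(3)] assms(5) by blast
  qed
  ultimately show ?thesis by (simp add: represents_mesh_def)
qed

lemma represents_mesh_amp_init:
  assumes "admissible_initial B" "\<rho> \<in> resolutions B"
  shows "represents_mesh B (amp_init B \<rho>)"
proof -
  have B: "\<And>K. K \<in> tets B \<Longrightarrow> tetrahedron K" "face_marking (tets B) (fmark B)"
    "admissible (tets B) (fmark B)" "\<And>K. K \<in> tets B \<Longrightarrow> \<not> eps B K"
    using assms(1) by (auto simp: admissible_initial_def tetrahedral_mesh_def)
  have g: "(if K \<in> D0 B then \<rho> K else (THE e. e \<in> gedges (fmark B) K)) \<in> gedges (fmark B) K"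
    if K: "K \<in> tets B" for K
  proof (cases "K \<in> D0 B")
    case True
    then show ?thesis using assms(2) by (auto simp: resolutions_def)
  next
    case False
    obtain e where e: "e \<in> gedges (fmark B) K" using B(3) K by (auto simp: admissible_def)
    then have eK: "e \<in> edges K" by (simp add: gedges_def)
    then obtain x where "x \<in> e" by (auto simp: edges_def card_2_iff)
    then obtain b c d where l: "labels K e x b c d"
      using labels_exist[OF _ eK] B(1)[OF K] by (metis tetrahedron_def)
    \<comment> \<open>A second global edge could only be the opposite one, and then \<open>K\<close>
      would belong to \<open>D0 B\<close>. Hence the definite description in \<open>amp_init\<close>
      is proper.\<close>
    have "gedges (fmark B) K = {e}"
    proof (rule ccontr)
      assume "gedges (fmark B) K \<noteq> {e}"
      then have "gedges (fmark B) K = {e, {c, d}}" "e \<noteq> {c, d}"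
        using gedges_opposite[OF l e] e by blast+
      then have "card (gedges (fmark B) K) = 2" by simp
      then show False using False K by (simp add: D0_def)
    qed
    then show ?thesis using False by simp
  qed
  have "represents B t" if t: "t \<in> amp_init B \<rho>" for t
  proof -
    have "refedge t \<in> gedges (fmark B) (verts t)" "verts t \<in> tets B" "mark t = fmark B" "\<not> flag t"
      using t g unfolding amp_init_def by auto
    then show ?thesis
      using B unfolding represents_def marked_tetrahedron_def gedges_def face_marking_def by auto
  qed
  then show ?thesis
    unfolding represents_mesh_def by (auto simp: amp_init_def image_image inj_on_def)
qed


section \<open>Histories\<close>

locale bansch_run =
  fixes B0 :: bmesh and \<sigma> :: "nat \<Rightarrow> strategy" and H :: history
  assumes init: "admissible_initial B0"
    and strategy: "\<And>i. selection_strategy B0 (\<sigma> i)"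
    and history: "bansch_history B0 \<sigma> H"
begin

definition performed :: "nat \<Rightarrow> nat \<Rightarrow> bool" where
  "performed i j \<longleftrightarrow> enat i < ncalls H \<and> enat j < nbatches H i"

text \<open>This is the order of execution; the bound on \<open>l\<close> for earlier calls discards
  indices of batches that never took place.\<close>

definition before :: "nat \<Rightarrow> nat \<Rightarrow> nat \<Rightarrow> nat \<Rightarrow> bool" where
  "before k l i j \<longleftrightarrow> k < i \<and> enat l < nbatches H k \<or> k = i \<and> l < j"

abbreviation mesh :: "nat \<Rightarrow> nat \<Rightarrow> tet set" where
  "mesh i j \<equiv> tets (bstate H i j)"

text \<open>The end of a call and the start of the next are two index pairs with one Baensch state.
  They need a case of their own because AMP has to make a return step between them.\<close>

lemma boundary_induct [consumes 1, case_names initial batch call]: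
  assumes "boundary H i j"
    and initial: "P 0 0"
    and batch: "\<And>i j. performed i j \<Longrightarrow> boundary H i j \<Longrightarrow> P i j \<Longrightarrow> P i (Suc j)"
    and call: "\<And>i l. enat (Suc i) < ncalls H \<Longrightarrow> nbatches H i = enat l \<Longrightarrow> hset H i l = {} \<Longrightarrow>
      bstate H (Suc i) 0 = bstate H i l \<Longrightarrow> boundary H i l \<Longrightarrow> P i l \<Longrightarrow> P (Suc i) 0"
  shows "P i j"
proof -
  have step: "P i j" if "boundary H i j" "P i 0" for i j
    using that
  proof (induction j)
    case (Suc j)
    then have "enat i < ncalls H" "enat (Suc j) \<le> nbatches H i" by (auto simp: boundary_def)
    then have "performed i j" "boundary H i j"
      by (auto simp: performed_def boundary_def Suc_ile_eq intro: less_imp_le)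
    then show ?case using batch Suc by blast
  qed
  have "boundary H i 0 \<Longrightarrow> P i 0" for i
  proof (induction i)
    case (Suc i)
    then have i: "enat (Suc i) < ncalls H" by (simp add: boundary_def)
    then obtain l where l: "nbatches H i = enat l" "hset H i l = {}"
      "bstate H (Suc i) 0 = bstate H i l"
      using history by (auto simp: bansch_history_def)
    have "enat i < ncalls H" using i by (meson enat_ord_simps(2) lessI less_trans)
    then have "boundary H i 0" "boundary H i l" using l(1) by (auto simp: boundary_def zero_enat_def[symmetric])
    then show ?case using call[OF i l] step Suc.IH by blast
  qed (rule initial)
  moreover have "boundary H i 0" using assms(1) by (auto simp: boundary_def zero_enat_def[symmetric])
  ultimately show ?thesis using step assms(1) by blast
qed

lemma
  assumes "performed i j"
  shows hset_nonempty: "hset H i j \<noteq> {}"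
    and performed_batch: "bansch_batch (bstate H i j) (hset H i j) (bedge H i j) (bstate H i (Suc j))"
    and bedge: "K \<in> hset H i j \<Longrightarrow>
      if K \<in> D0 B0 then bedge H i j K \<in> gedges (fmark B0) K
      else gedges (fmark (bstate H i j)) K = {bedge H i j K}"
    and hset_subset: "hset H i j \<subseteq> mesh i j"
proof -
  have *: "enat i < ncalls H" "enat j < nbatches H i" using assms by (auto simp: performed_def)
  have **: "hset H i j \<noteq> {}" "\<forall>K\<in>hset H i j.
              if K \<in> D0 B0 then bedge H i j K = \<sigma> i (past H i j) K
              else gedges (fmark (bstate H i j)) K = {bedge H i j K}"
    "bansch_batch (bstate H i j) (hset H i j) (bedge H i j) (bstate H i (Suc j))"
    "marking H i \<subseteq> mesh i 0"
    using history * unfolding bansch_history_def by blast+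
  show "hset H i j \<noteq> {}" "bansch_batch (bstate H i j) (hset H i j) (bedge H i j) (bstate H i (Suc j))"
    by fact+
  show "if K \<in> D0 B0 then bedge H i j K \<in> gedges (fmark B0) K
      else gedges (fmark (bstate H i j)) K = {bedge H i j K}" if "K \<in> hset H i j"
    using bspec[OF **(2) that] strategy[of i] by (auto simp: selection_strategy_def)
  show "hset H i j \<subseteq> mesh i j"
    using **(4) by (auto simp: hset_def batch_set_def hanging_elements_def)
qed

lemma bedge_edges: "performed i j \<Longrightarrow> K \<in> hset H i j \<Longrightarrow> bedge H i j K \<in> edges K"
  using bedge[of i j K] by (auto simp: gedges_def split: if_splits)

lemma nonoverlapping_initial: "nonoverlapping (tets B0)"
  using init by (auto simp: admissible_initial_def tetrahedral_mesh_def nonoverlapping_def)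

text \<open>The claims are proved by one induction: a bisected initial tetrahedron leaves the mesh,
  and it cannot come back because every child lies in an initial tetrahedron and
  \<open>child_notin\<close> applies to the initial mesh.\<close>

lemma
  assumes "boundary H i j"
  shows nonoverlapping_mesh: "nonoverlapping (mesh i j)"
    and mesh_ancestor: "\<forall>L\<in>mesh i j. \<exists>K\<in>tets B0. convex hull L \<subseteq> convex hull K"
    and initial_unbisected: "\<forall>K\<in>tets B0 \<inter> mesh i j. \<forall>k l. before k l i j \<longrightarrow> K \<notin> hset H k l"
proof -
  have "nonoverlapping (mesh i j) \<and> (\<forall>L\<in>mesh i j. \<exists>K\<in>tets B0. convex hull L \<subseteq> convex hull K) \<and>
    (\<forall>K\<in>tets B0 \<inter> mesh i j. \<forall>k l. before k l i j \<longrightarrow> K \<notin> hset H k l)"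
    using assms
  proof (induction rule: boundary_induct)
    case initial
    have "bstate H 0 0 = B0" using history by (simp add: bansch_history_def)
    then show ?case using nonoverlapping_initial by (auto simp: before_def)
  next
    case (batch i j)
    let ?S = "hset H i j" and ?E = "bedge H i j"
    have m: "mesh i (Suc j) = bisect (mesh i j) ?S ?E"
      using tets_bansch_batch[OF performed_batch[OF batch(1)]] .
    have no: "nonoverlapping (mesh i j)"
      and anc: "\<And>L. L \<in> mesh i j \<Longrightarrow> \<exists>K\<in>tets B0. convex hull L \<subseteq> convex hull K"
      and un: "\<And>K k l. K \<in> tets B0 \<Longrightarrow> K \<in> mesh i j \<Longrightarrow> before k l i j \<Longrightarrow> K \<notin> hset H k l"
      using batch(3) by auto
    have child: "(\<exists>K0\<in>tets B0. convex hull (child K (?E K) x) \<subseteq> convex hull K0) \<and>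
        child K (?E K) x \<notin> tets B0" if K: "K \<in> ?S" "x \<in> ?E K" for K x
    proof -
      have KS: "K \<in> mesh i j" using hset_subset[OF batch(1)] K(1) by blast
      have tet: "tetrahedron K" using no KS by (simp add: nonoverlapping_def)
      note E = bedge_edges[OF batch(1) K(1)]
      obtain K0 where "K0 \<in> tets B0" "convex hull K \<subseteq> convex hull K0" using anc[OF KS] by blast
      then show ?thesis
        using child_properties(2)[OF tet E K(2)]
          child_notin[OF nonoverlapping_initial _ _ tet E K(2)] by blast
    qed
    have "nonoverlapping (mesh i (Suc j))"
      unfolding m
      using nonoverlapping_bisect[OF no hset_subset[OF batch(1)]] bedge_edges[OF batch(1)] by blast
    moreover have "\<forall>L\<in>mesh i (Suc j). \<exists>K\<in>tets B0. convex hull L \<subseteq> convex hull K"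
      unfolding m bisect_def using anc child by blast
    moreover have "K \<notin> hset H k l"
      if "K \<in> tets B0" "K \<in> mesh i (Suc j)" "before k l i (Suc j)" for K k l
    proof -
      have "K \<in> mesh i j - ?S" using that(1,2) child unfolding m bisect_def by blast
      moreover have "before k l i j \<or> k = i \<and> l = j"
        using that(3) by (auto simp: before_def less_Suc_eq)
      ultimately show ?thesis using un[OF that(1)] by blast
    qed
    ultimately show ?case by blast
  next
    case (call i l)
    \<comment> \<open>Call \<open>i\<close> consists of exactly \<open>l\<close> batches, so the
      same batches precede both boundaries.\<close>
    have "before k l' (Suc i) 0 \<longleftrightarrow> before k l' i l" for k l'
      using call(2) by (auto simp: before_def less_Suc_eq)
    then show ?case using call by simp
  qed
  then show "nonoverlapping (mesh i j)"
    "\<forall>L\<in>mesh i j. \<exists>K\<in>tets B0. convex hull L \<subseteq> convex hull K"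
    "\<forall>K\<in>tets B0 \<inter> mesh i j. \<forall>k l. before k l i j \<longrightarrow> K \<notin> hset H k l" by auto
qed

lemma performed_boundary: "performed i j \<Longrightarrow> boundary H i j"
  by (simp add: performed_def boundary_def less_imp_le)

text \<open>Bisected tetrahedra are active, so of two different batches the earlier one would
  contradict \<open>initial_unbisected\<close> at the later one.\<close>

lemma initial_bisected_once:
  assumes "performed i j" "performed k l" "K \<in> tets B0" "K \<in> hset H i j" "K \<in> hset H k l"
  shows "i = k \<and> j = l"
proof -
  have "\<not> before k l i j"
    using initial_unbisected[OF performed_boundary[OF assms(1)]] hset_subset[OF assms(1)] assms(3-5)
    by blast
  moreover have "\<not> before i j k l"
    using initial_unbisected[OF performed_boundary[OF assms(2)]] hset_subset[OF assms(2)] assms(3-5)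
    by blast
  ultimately show ?thesis
    using assms(1,2) by (auto simp: before_def performed_def)
qed

text \<open>The value at \<open>K\<close> is the edge of its only bisection, wherever in the history
  that occurs, and an arbitrary global edge if \<open>K\<close> is never bisected. No dependence of
  the strategy on the past can thus produce conflicting demands.\<close>

lemma resolution_exists:
  "\<exists>\<rho>\<in>resolutions B0. \<forall>i j. performed i j \<longrightarrow>
     (\<forall>K\<in>hset H i j \<inter> D0 B0. bedge H i j K = \<rho> K)"
proof -
  have "\<exists>e. e \<in> gedges (fmark B0) K \<and>
      (\<forall>i j. performed i j \<longrightarrow> K \<in> hset H i j \<longrightarrow> bedge H i j K = e)" if K: "K \<in> D0 B0" for K
  proof (cases "\<exists>i j. performed i j \<and> K \<in> hset H i j")
    case True
    then obtain i j where ij: "performed i j" "K \<in> hset H i j" by blast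
    have K0: "K \<in> tets B0" using K by (simp add: D0_def)
    have "\<forall>k l. performed k l \<longrightarrow> K \<in> hset H k l \<longrightarrow> bedge H k l K = bedge H i j K"
      using initial_bisected_once[OF ij(1) _ K0 ij(2)] by blast
    moreover have "bedge H i j K \<in> gedges (fmark B0) K" using bedge[OF ij] K by simp
    ultimately show ?thesis by blast
  next
    case False
    have "gedges (fmark B0) K \<noteq> {}" using K by (auto simp: D0_def)
    then show ?thesis using False by blast
  qed
  then obtain f where f: "\<And>K. K \<in> D0 B0 \<Longrightarrow> f K \<in> gedges (fmark B0) K \<and>
      (\<forall>i j. performed i j \<longrightarrow> K \<in> hset H i j \<longrightarrow> bedge H i j K = f K)" by metis
  have "restrict f (D0 B0) \<in> resolutions B0" using f by (auto simp: resolutions_def)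
  then show ?thesis by (rule bexI[rotated]) (use f in auto)
qed

section \<open>The AMP execution for the resolution read off from the history\<close>

context
  fixes \<rho> assumes \<rho>: "\<rho> \<in> resolutions B0"
    and bedge_\<rho>: "\<And>i j K. performed i j \<Longrightarrow> K \<in> hset H i j \<Longrightarrow> K \<in> D0 B0 \<Longrightarrow> bedge H i j K = \<rho> K"
begin

text \<open>Correspondence only places the refinement edge among the global edges, which decides the
  matter when there is one. For \<open>K\<close> in \<open>D0 B0\<close> the AMP record must still
  be the initial one, carrying \<open>\<rho> K\<close>; hence the extra invariant on
  \<open>amp_init\<close>.\<close>

lemma refedge_eq_bedge:
  assumes "performed i j" "represents_mesh (bstate H i j) T"
    "\<forall>t\<in>T. verts t \<in> tets B0 \<longrightarrow> t \<in> amp_init B0 \<rho>" "t \<in> T" "verts t \<in> hset H i j"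
  shows "bedge H i j (verts t) = refedge t"
proof (cases "verts t \<in> D0 B0")
  case True
  then have "t \<in> amp_init B0 \<rho>" using assms(3,4) by (auto simp: D0_def)
  then have "refedge t = \<rho> (verts t)" using True by (auto simp: amp_init_def)
  then show ?thesis using bedge_\<rho>[OF assms(1,5) True] by simp
next
  case False
  have "corresponding (bstate H i j) t"
    using assms(2,4) by (auto simp: represents_mesh_def intro: represents_corresponding)
  then have "refedge t \<in> gedges (fmark (bstate H i j)) (verts t)"
    by (simp add: corresponding_def Let_def)
  then show ?thesis using bedge[OF assms(1,5)] False by simp
qed

lemma amp_execution:
  assumes "boundary H i j"
  shows "\<exists>T. amp_reach (amp_init B0 \<rho>) (marking H) i j T \<and> represents_mesh (bstate H i j) T \<and>
    (\<forall>t\<in>T. verts t \<in> tets B0 \<longrightarrow> t \<in> amp_init B0 \<rho>)"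
  using assms
proof (induction rule: boundary_induct)
  case initial
  have "bstate H 0 0 = B0" using history by (simp add: bansch_history_def)
  then show ?case
    using represents_mesh_amp_init[OF init \<rho>] amp_reach.start by auto
next
  case (batch i j)
  let ?S = "hset H i j"
  obtain T where T: "amp_reach (amp_init B0 \<rho>) (marking H) i j T"
    "represents_mesh (bstate H i j) T" "\<forall>t\<in>T. verts t \<in> tets B0 \<longrightarrow> t \<in> amp_init B0 \<rho>"
    using batch(3) by blast
  have vT: "verts ` T = mesh i j" using T(2) by (simp add: represents_mesh_def)
  have S: "batch_set (marking H i) (verts ` T) j = ?S" by (simp add: hset_def vT)
  have "amp_reach (amp_init B0 \<rho>) (marking H) i (Suc j) (amp_batch T ?S)"
  proof (cases j)
    case 0
    then have "marking H i \<subseteq> verts ` T"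
      using hset_subset[OF batch(1)] by (simp add: vT hset_def batch_set_def)
    from amp_reach.first[OF T(1)[unfolded 0] this] show ?thesis using S 0 by simp
  next
    case (Suc n)
    then have "hanging_elements (verts ` T) \<noteq> {}"
      using hset_nonempty[OF batch(1)] by (simp add: vT hset_def batch_set_def)
    from amp_reach.loop[OF T(1)[unfolded Suc] this] show ?thesis using S Suc by simp
  qed
  moreover have "represents_mesh (bstate H i (Suc j)) (amp_batch T ?S)"
    using represents_mesh_batch[OF T(2) nonoverlapping_mesh[OF batch(2)] performed_batch[OF batch(1)]
        hset_subset[OF batch(1)] refedge_eq_bedge[OF batch(1) T(2,3)]] .
  moreover have "t \<in> amp_init B0 \<rho>" if t: "t \<in> amp_batch T ?S" "verts t \<in> tets B0" for t
    using t(1) unfolding amp_batch_def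
  proof
    \<comment> \<open>The invariant on initial records survives since no child is an initial
      tetrahedron.\<close>
    assume "t \<in> (\<Union>s\<in>{s \<in> T. verts s \<in> ?S}. amp_child s ` refedge s)"
    then obtain s x where s: "s \<in> T" "x \<in> refedge s" "t = amp_child s x" by auto
    have "tetrahedron (verts s)" "refedge s \<in> edges (verts s)"
      using T(2) s(1) by (auto simp: represents_mesh_def represents_def marked_tetrahedron_def)
    moreover obtain K0 where "K0 \<in> tets B0" "convex hull (verts s) \<subseteq> convex hull K0"
      using mesh_ancestor[OF batch(2)] s(1) vT by blast
    ultimately have "verts t \<notin> tets B0"
      using child_notin[OF nonoverlapping_initial] s(2,3) by (simp add: verts_amp_child)
    then show ?thesis using t(2) by blast
  qed (use T(3) t(2) in auto)
  ultimately show ?case by blast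
next
  case (call i l)
  obtain T where T: "amp_reach (amp_init B0 \<rho>) (marking H) i l T"
    "represents_mesh (bstate H i l) T" "\<forall>t\<in>T. verts t \<in> tets B0 \<longrightarrow> t \<in> amp_init B0 \<rho>"
    using call(6) by blast
  have vT: "verts ` T = mesh i l" using T(2) by (simp add: represents_mesh_def)
  have "amp_reach (amp_init B0 \<rho>) (marking H) (Suc i) 0 T"
  proof (cases l)
    case 0
    \<comment> \<open>The marking set is empty, and the AMP call still performs one (empty) batch.\<close>
    have "marking H i = {}" using call(3) 0 by (simp add: hset_def batch_set_def)
    then have "amp_reach (amp_init B0 \<rho>) (marking H) i (Suc 0) T"
      using amp_reach.first[OF T(1)[unfolded 0]] by (simp add: batch_set_def amp_batch_def)
    moreover have "conforming (mesh (Suc i) 0)"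
      using history call(1) by (simp add: bansch_history_def)
    then have "hanging_elements (verts ` T) = {}"
      using conforming_no_hanging[of "mesh i l"] nonoverlapping_mesh[OF call(5)] call(4)
      by (simp add: vT nonoverlapping_def)
    ultimately show ?thesis by (rule amp_reach.return)
  next
    case (Suc n)
    then have "hanging_elements (verts ` T) = {}"
      using call(3) by (simp add: vT hset_def batch_set_def)
    then show ?thesis using amp_reach.return T(1) Suc by blast
  qed
  then show ?case using T call(4) by auto
qed

lemma performed_same_bisections:
  assumes "performed i j"
  shows "same_bisections H (amp_init B0 \<rho>) i j"
proof -
  obtain T where T: "amp_reach (amp_init B0 \<rho>) (marking H) i j T"
    "represents_mesh (bstate H i j) T" "\<forall>t\<in>T. verts t \<in> tets B0 \<longrightarrow> t \<in> amp_init B0 \<rho>"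
    using amp_execution[OF performed_boundary[OF assms]] by blast
  have vT: "verts ` T = mesh i j" using T(2) by (simp add: represents_mesh_def)
  have "hbatch H i j = {(verts t, refedge t) | t. t \<in> T \<and> verts t \<in> hset H i j}"
  proof (intro equalityI subsetI)
    fix p assume "p \<in> hbatch H i j"
    then obtain K where K: "K \<in> hset H i j" "p = (K, bedge H i j K)" by (auto simp: hbatch_def)
    then obtain t where "t \<in> T" "verts t = K" using hset_subset[OF assms] unfolding vT[symmetric] by auto
    then show "p \<in> {(verts t, refedge t) | t. t \<in> T \<and> verts t \<in> hset H i j}"
      using K refedge_eq_bedge[OF assms T(2,3)] by auto
  next
    fix p assume "p \<in> {(verts t, refedge t) | t. t \<in> T \<and> verts t \<in> hset H i j}"
    then show "p \<in> hbatch H i j"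
      using refedge_eq_bedge[OF assms T(2,3)] by (auto simp: hbatch_def)
  qed
  then show ?thesis 
    unfolding same_bisections_def using T(1) vT by (intro exI[of _ T]) (simp add: hset_def)
qed

end

end

theorem theorem6p6:
  fixes B0 :: bmesh and \<sigma> :: "nat \<Rightarrow> strategy" and H :: history
  assumes "admissible_initial B0"
    and "\<forall>i. selection_strategy B0 (\<sigma> i)"
    and "bansch_history B0 \<sigma> H"
  shows "\<exists>\<rho>\<in>resolutions B0. \<forall>i j. boundary H i j \<longrightarrow>
    (\<exists>T. amp_reach (amp_init B0 \<rho>) (marking H) i j T \<and> matching (bstate H i j) T) \<and>
    (\<forall>k l. k < i \<and> enat l < nbatches H k \<or> k = i \<and> l < j \<longrightarrow>
       same_bisections H (amp_init B0 \<rho>) k l)"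
proof -
  interpret bansch_run B0 \<sigma> H using assms by unfold_locales auto
  obtain \<rho> where \<rho>: "\<rho> \<in> resolutions B0" and
    *: "\<And>i j K. performed i j \<Longrightarrow> K \<in> hset H i j \<Longrightarrow> K \<in> D0 B0 \<Longrightarrow> bedge H i j K = \<rho> K"
    using resolution_exists by blast
  have "performed k l" if "boundary H i j" "k < i \<and> enat l < nbatches H k \<or> k = i \<and> l < j" for i j k l
  proof -
    \<comment> \<open>No batch precedes the initial boundary, so a boundary preceded by a batch lies
      in a genuine call.\<close>
    have "enat i < ncalls H" using that by (auto simp: boundary_def)
    moreover from this have "k \<le> i \<Longrightarrow> enat k < ncalls H" by (meson enat_ord_simps(1) le_less_trans)
    moreover have "k = i \<Longrightarrow> l < j \<Longrightarrow> enat l < nbatches H i"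
      using that by (auto simp: boundary_def intro: less_le_trans[of _ "enat j"])
    ultimately show ?thesis using that(2) by (auto simp: performed_def)
  qed
  note performed = this
  show ?thesis
  proof (intro bexI[OF _ \<rho>] allI impI conjI)
    fix i j assume b: "boundary H i j"
    show "\<exists>T. amp_reach (amp_init B0 \<rho>) (marking H) i j T \<and> matching (bstate H i j) T"
      using amp_execution[OF \<rho> * b] represents_mesh_matching by blast
    show "same_bisections H (amp_init B0 \<rho>) k l"
      if "k < i \<and> enat l < nbatches H k \<or> k = i \<and> l < j" for k l
      using performed_same_bisections[OF \<rho> *] performed[OF b that] by blast
  qed
qed

end
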